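(* Let the Lagrange multipliers $(\lambda,\gamma)$ evolve in time with given velocities $(\dot\lambda,\dot\gamma)$, and let the parameters $\theta\in\Theta_{\lambda,\gamma}$ evolve quasi-statically, i.e. so that they stay on the equilibrium surface and $\frac{d}{dt}\nabla_\theta J(\theta,\lambda,\gamma)=0$ at each time. Then the parameters evolve as $$\dot\theta=A^{-1}b_\lambda\,\dot\lambda+A^{-1}b_\gamma\,\dot\gamma=\theta_\lambda\,\dot\lambda+\theta_\gamma\,\dot\gamma,$$ where $$A=\nabla_\theta^2J=\mathbb{E}_{x\sim p(x)}\Big[\langle\nabla_\theta^2H\rangle+\langle\nabla_\theta H\rangle\langle\nabla_\theta H\rangle^\top-\langle\nabla_\theta H\,\nabla_\theta^\top H\rangle\Big],$$ $$b_\lambda=-\frac{\partial}{\partial\lambda}\nabla_\theta J=-\mathbb{E}_{x\sim p(x)}\Big[\Big\langle\frac{\partial\nabla_\theta H}{\partial\lambda}\Big\rangle-\Big\langle\frac{\partial H}{\partial\lambda}\nabla_\theta H\Big\rangle+\Big\langle\frac{\partial H}{\partial\lambda}\Big\rangle\langle\nabla_\theta H\rangle\Big],$$ $$b_\gamma=-\frac{\partial}{\partial\gamma}\nabla_\theta J=-\mathbb{E}_{x\sim p(x)}\Big[\Big\langle\frac{\partial\nabla_\theta H}{\partial\gamma}\Big\rangle-\Big\langle\frac{\partial H}{\partial\gamma}\nabla_\theta H\Big\rangle+\Big\langle\frac{\partial H}{\partial\gamma}\Big\rangle\langle\nabla_\theta H\rangle\Big].$$ The dynamics of $\theta$ is therefore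 a function of the two directional derivatives $\theta_\lambda=A^{-1}b_\lambda$ and $\theta_\gamma=A^{-1}b_\gamma$ with respect to $\lambda$ and $\gamma$. Moreover, $A$ is the Hessian of a strictly convex functional.
   Context: Data $x$ have distribution $p(x)$, and each $x$ has a deterministic true label $y_x$. For parameters $\theta\in\Theta\subseteq\mathbb{R}^N$ there are a density $m_\theta(z)$ on latent codes $z$, a decoder density $d_\theta(x|z)$ and a classifier $c_\theta(y|z)$. The Hamiltonian is $$H(z;x,\theta,\lambda,\gamma)=-\log m_\theta(z)-\lambda\log d_\theta(x|z)-\gamma\log c_\theta(y_x|z).$$ Put $Z_{\theta,x}=\int m_\theta(z)\,d_\theta(x|z)^\lambda\,c_\theta(y_x|z)^\gamma\,dz=\int e^{-H}\,dz$, $J(\theta,\lambda,\gamma)=-\mathbb{E}_{x\sim p(x)}[\log Z_{\theta,x}]$, $F(\lambda,\gamma)=\min_{\theta\in\Theta}J(\theta,\lambda,\gamma)$, and define the equilibrium surface $\Theta_{\lambda,\gamma}=\{\theta\in\Theta: J(\theta,\lambda,\gamma)=F(\lambda,\gamma)\}$; on it $\nabla_\theta J=0$. For fixed $x$, $\langle\varphi\rangle=\int\varphi\,e^{-H}\,dz\big/\int e^{-H}\,dz$ is the average over $z$ with respect to the Gibbs measure of the Hamiltonian. A dot denotes $d/dt$.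
   Formalization: Added: m, d, c positive, H is C² in θ with its derivatives (first ones squared) locally dominated, J finite and bounded below on Θ, θ interior to Θ, A invertible. J is shown strictly convex only near θ(t), since it need not be convex on all of Θ. *)

theory Defs
  imports "HOL-Probability.Probability"
begin

definition grad :: "('a::real_inner \<Rightarrow> real) \<Rightarrow> 'a \<Rightarrow> 'a" where
  "grad f x = (THE D. GDERIV f x :> D)"

definition hess :: "(real^'n \<Rightarrow> real) \<Rightarrow> real^'n \<Rightarrow> real^'n^'n" where
  "hess f x = jacobian (grad f) (at x)"

definition C2_on :: "(real^'n) set \<Rightarrow> (real^'n \<Rightarrow> real) \<Rightarrow> bool" where
  "C2_on S f \<longleftrightarrow>
     (\<forall>x\<in>S. f differentiable (at x)) \<and>
     (\<forall>x\<in>S. grad f differentiable (at x)) \<and>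
     continuous_on S (hess f)"

definition outer :: "real^'n \<Rightarrow> real^'n \<Rightarrow> real^'n^'n" where
  "outer u v = (\<chi> i j. u $ i * v $ j)"

definition strictly_convex_on :: "'a::real_vector set \<Rightarrow> ('a \<Rightarrow> real) \<Rightarrow> bool" where
  "strictly_convex_on S f \<longleftrightarrow> convex S \<and>
     (\<forall>x\<in>S. \<forall>y\<in>S. \<forall>u. x \<noteq> y \<and> 0 < u \<and> u < 1 \<longrightarrow>
        f ((1 - u) *\<^sub>R x + u *\<^sub>R y) < (1 - u) * f x + u * f y)"

text \<open>
  The field \<open>data_dist\<close> is the law of the data, \<open>label x\<close> the true label of \<open>x\<close>,
  \<open>prior \<theta> z\<close> the density of the codes, \<open>decoder \<theta> z x\<close> the conditional density of \<open>x\<close>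
  given \<open>z\<close>, \<open>classifier \<theta> z\<close> the conditional law of the label given \<open>z\<close>, and \<open>params\<close>
  the parameter set.
\<close>

record ('x, 'y, 'z, 'n) latent_model =
  data_dist :: "'x measure"
  label :: "'x \<Rightarrow> 'y"
  prior :: "real^'n \<Rightarrow> 'z \<Rightarrow> real"
  decoder :: "real^'n \<Rightarrow> 'z \<Rightarrow> 'x \<Rightarrow> real"
  classifier :: "real^'n \<Rightarrow> 'z \<Rightarrow> 'y pmf"
  params :: "(real^'n) set"

text \<open>
  Strict positivity says that the Hamiltonian, which contains the logarithms of the three
  densities, is finite.
\<close>

definition wf_model ::
    "('x::euclidean_space, 'y::countable, 'z::euclidean_space, 'n::finite) latent_model \<Rightarrow> bool" where
  "wf_model M \<longleftrightarrow>
     prob_space (data_dist M) \<and> sets (data_dist M) = sets borel \<and>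
     label M \<in> borel \<rightarrow>\<^sub>M count_space UNIV \<and>
     (\<forall>\<theta>\<in>params M.
        prior M \<theta> \<in> borel_measurable borel \<and>
        (\<lambda>(z, x). decoder M \<theta> z x) \<in> borel_measurable borel \<and>
        (\<forall>y. (\<lambda>z. pmf (classifier M \<theta> z) y) \<in> borel_measurable borel) \<and>
        (\<forall>z. 0 < prior M \<theta> z) \<and>
        (\<forall>z x. 0 < decoder M \<theta> z x) \<and>
        (\<forall>z x. 0 < pmf (classifier M \<theta> z) (label M x)) \<and>
        prob_space (density lborel (\<lambda>z. ennreal (prior M \<theta> z))) \<and>
        (\<forall>z. prob_space (density lborel (\<lambda>x. ennreal (decoder M \<theta> z x)))))"

definition hamiltonian ::
    "('x, 'y, 'z, 'n::finite) latent_model \<Rightarrow> 'z \<Rightarrow> 'x \<Rightarrow> real^'n \<Rightarrow> real \<Rightarrow> real \<Rightarrow> real" where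
  "hamiltonian M z x \<theta> l g =
     - ln (prior M \<theta> z) - l * ln (decoder M \<theta> z x) - g * ln (pmf (classifier M \<theta> z) (label M x))"

definition boltzmann_weight ::
    "('x, 'y, 'z, 'n::finite) latent_model \<Rightarrow> 'x \<Rightarrow> real^'n \<Rightarrow> real \<Rightarrow> real \<Rightarrow> 'z \<Rightarrow> real" where
  "boltzmann_weight M x \<theta> l g z =
     prior M \<theta> z * decoder M \<theta> z x powr l * pmf (classifier M \<theta> z) (label M x) powr g"

definition partition_fn ::
    "('x, 'y, 'z::euclidean_space, 'n::finite) latent_model \<Rightarrow> 'x \<Rightarrow> real^'n \<Rightarrow> real \<Rightarrow> real \<Rightarrow> real" where
  "partition_fn M x \<theta> l g = (\<integral>z. boltzmann_weight M x \<theta> l g z \<partial>lborel)"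

definition J_fun ::
    "('x, 'y, 'z::euclidean_space, 'n::finite) latent_model \<Rightarrow> real^'n \<Rightarrow> real \<Rightarrow> real \<Rightarrow> real" where
  "J_fun M \<theta> l g = - (\<integral>x. ln (partition_fn M x \<theta> l g) \<partial>data_dist M)"

text \<open>The Bochner integral of a non-integrable function is \<open>0\<close>, so finiteness of \<open>J\<close> is a
  separate condition.\<close>

definition J_finite ::
    "('x, 'y, 'z::euclidean_space, 'n::finite) latent_model \<Rightarrow> real^'n \<Rightarrow> real \<Rightarrow> real \<Rightarrow> bool" where
  "J_finite M \<theta> l g \<longleftrightarrow>
     (\<forall>x. integrable lborel (boltzmann_weight M x \<theta> l g)) \<and>
     integrable (data_dist M) (\<lambda>x. ln (partition_fn M x \<theta> l g))"

text \<open>The infimum is a minimum wherever \<open>equilibrium_surface\<close> below is nonempty and \<open>J\<close> is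
  bounded below; without a lower bound the value is meaningless.\<close>

definition F_fun ::
    "('x, 'y, 'z::euclidean_space, 'n::finite) latent_model \<Rightarrow> real \<Rightarrow> real \<Rightarrow> real" where
  "F_fun M l g = (INF \<theta>\<in>params M. J_fun M \<theta> l g)"

definition equilibrium_surface ::
    "('x, 'y, 'z::euclidean_space, 'n::finite) latent_model \<Rightarrow> real \<Rightarrow> real \<Rightarrow> (real^'n) set" where
  "equilibrium_surface M l g = {\<theta> \<in> params M. J_fun M \<theta> l g = F_fun M l g}"

text \<open>The first argument is the Hamiltonian as a function of \<open>z\<close>.\<close>

definition gibbs_avg ::
    "('z::euclidean_space \<Rightarrow> real) \<Rightarrow> ('z \<Rightarrow> 'b::{banach, second_countable_topology}) \<Rightarrow> 'b" where
  "gibbs_avg h \<phi> = (\<integral>z. exp (- h z) *\<^sub>R \<phi> z \<partial>lborel) /\<^sub>R (\<integral>z. exp (- h z) \<partial>lborel)"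

definition grad_H ::
    "('x, 'y, 'z, 'n::finite) latent_model \<Rightarrow> 'z \<Rightarrow> 'x \<Rightarrow> real^'n \<Rightarrow> real \<Rightarrow> real \<Rightarrow> real^'n" where
  "grad_H M z x \<theta> l g = grad (\<lambda>\<theta>. hamiltonian M z x \<theta> l g) \<theta>"

definition hess_H ::
    "('x, 'y, 'z, 'n::finite) latent_model \<Rightarrow> 'z \<Rightarrow> 'x \<Rightarrow> real^'n \<Rightarrow> real \<Rightarrow> real \<Rightarrow> real^'n^'n" where
  "hess_H M z x \<theta> l g = hess (\<lambda>\<theta>. hamiltonian M z x \<theta> l g) \<theta>"

definition dlam_H ::
    "('x, 'y, 'z, 'n::finite) latent_model \<Rightarrow> 'z \<Rightarrow> 'x \<Rightarrow> real^'n \<Rightarrow> real \<Rightarrow> real \<Rightarrow> real" where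
  "dlam_H M z x \<theta> l g = deriv (\<lambda>l. hamiltonian M z x \<theta> l g) l"

definition dgam_H ::
    "('x, 'y, 'z, 'n::finite) latent_model \<Rightarrow> 'z \<Rightarrow> 'x \<Rightarrow> real^'n \<Rightarrow> real \<Rightarrow> real \<Rightarrow> real" where
  "dgam_H M z x \<theta> l g = deriv (\<lambda>g. hamiltonian M z x \<theta> l g) g"

definition dlam_grad_H ::
    "('x, 'y, 'z, 'n::finite) latent_model \<Rightarrow> 'z \<Rightarrow> 'x \<Rightarrow> real^'n \<Rightarrow> real \<Rightarrow> real \<Rightarrow> real^'n" where
  "dlam_grad_H M z x \<theta> l g = vector_derivative (\<lambda>l. grad_H M z x \<theta> l g) (at l)"

definition dgam_grad_H ::
    "('x, 'y, 'z, 'n::finite) latent_model \<Rightarrow> 'z \<Rightarrow> 'x \<Rightarrow> real^'n \<Rightarrow> real \<Rightarrow> real \<Rightarrow> real^'n" where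
  "dgam_grad_H M z x \<theta> l g = vector_derivative (\<lambda>g. grad_H M z x \<theta> l g) (at g)"

text \<open>
  Regularity of the model near a point \<open>(\<theta>, l, g)\<close>, which justifies differentiating twice under
  the integral over \<open>z\<close> and under the expectation over \<open>x\<close>: the Hamiltonian is \<open>C\<^sup>2\<close> in \<open>\<theta>\<close>
  (it is affine in the multipliers), and its first derivatives squared and its second derivatives
  are locally uniformly dominated, first against the unnormalized Gibbs weight for each \<open>x\<close>, then
  in Gibbs average by a function integrable in \<open>x\<close>.
\<close>

definition deriv_size ::
    "('x, 'y, 'z, 'n::finite) latent_model \<Rightarrow> 'x \<Rightarrow> real^'n \<Rightarrow> real \<Rightarrow> real \<Rightarrow> 'z \<Rightarrow> real" where
  "deriv_size M x \<theta> l g z =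
     1 + (norm (grad_H M z x \<theta> l g))\<^sup>2 + (dlam_H M z x \<theta> l g)\<^sup>2 + (dgam_H M z x \<theta> l g)\<^sup>2
       + norm (hess_H M z x \<theta> l g)
       + norm (dlam_grad_H M z x \<theta> l g) + norm (dgam_grad_H M z x \<theta> l g)"

definition regular_near ::
    "('x, 'y, 'z::euclidean_space, 'n::finite) latent_model \<Rightarrow> real^'n \<Rightarrow> real \<Rightarrow> real \<Rightarrow> bool" where
  "regular_near M \<theta>0 l0 g0 \<longleftrightarrow>
     (\<exists>r>0.
        (\<forall>x z l g. C2_on (ball \<theta>0 r) (\<lambda>\<theta>. hamiltonian M z x \<theta> l g)) \<and>
        (\<forall>x. \<exists>w. integrable lborel w \<and>
           (\<forall>\<theta>\<in>ball \<theta>0 r. \<forall>l\<in>ball l0 r. \<forall>g\<in>ball g0 r. \<forall>z.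
              exp (- hamiltonian M z x \<theta> l g) * deriv_size M x \<theta> l g z \<le> w z)) \<and>
        (\<exists>W. integrable (data_dist M) W \<and>
           (\<forall>\<theta>\<in>ball \<theta>0 r. \<forall>l\<in>ball l0 r. \<forall>g\<in>ball g0 r. \<forall>x.
              gibbs_avg (\<lambda>z. hamiltonian M z x \<theta> l g) (deriv_size M x \<theta> l g) \<le> W x)))"

definition A_mat ::
    "('x, 'y, 'z::euclidean_space, 'n::finite) latent_model \<Rightarrow> real^'n \<Rightarrow> real \<Rightarrow> real \<Rightarrow> real^'n^'n" where
  "A_mat M \<theta> l g = hess (\<lambda>\<theta>. J_fun M \<theta> l g) \<theta>"

definition grad_J ::
    "('x, 'y, 'z::euclidean_space, 'n::finite) latent_model \<Rightarrow> real^'n \<Rightarrow> real \<Rightarrow> real \<Rightarrow> real^'n" where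
  "grad_J M \<theta> l g = grad (\<lambda>\<theta>. J_fun M \<theta> l g) \<theta>"

definition b_lam ::
    "('x, 'y, 'z::euclidean_space, 'n::finite) latent_model \<Rightarrow> real^'n \<Rightarrow> real \<Rightarrow> real \<Rightarrow> real^'n" where
  "b_lam M \<theta> l g = - vector_derivative (\<lambda>l. grad_J M \<theta> l g) (at l)"

definition b_gam ::
    "('x, 'y, 'z::euclidean_space, 'n::finite) latent_model \<Rightarrow> real^'n \<Rightarrow> real \<Rightarrow> real \<Rightarrow> real^'n" where
  "b_gam M \<theta> l g = - vector_derivative (\<lambda>g. grad_J M \<theta> l g) (at g)"

definition theta_lam ::
    "('x, 'y, 'z::euclidean_space, 'n::finite) latent_model \<Rightarrow> real^'n \<Rightarrow> real \<Rightarrow> real \<Rightarrow> real^'n" where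
  "theta_lam M \<theta> l g = matrix_inv (A_mat M \<theta> l g) *v b_lam M \<theta> l g"

definition theta_gam ::
    "('x, 'y, 'z::euclidean_space, 'n::finite) latent_model \<Rightarrow> real^'n \<Rightarrow> real \<Rightarrow> real \<Rightarrow> real^'n" where
  "theta_gam M \<theta> l g = matrix_inv (A_mat M \<theta> l g) *v b_gam M \<theta> l g"

text \<open>Only continuity of the parameter path is required; its differentiability is a consequence.\<close>

definition quasi_static ::
    "('x, 'y, 'z::euclidean_space, 'n::finite) latent_model \<Rightarrow> real set \<Rightarrow>
     (real \<Rightarrow> real^'n) \<Rightarrow> (real \<Rightarrow> real) \<Rightarrow> (real \<Rightarrow> real) \<Rightarrow> bool" where
  "quasi_static M T \<theta> lam gam \<longleftrightarrow>
     continuous_on T \<theta> \<and>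
     (\<forall>t\<in>T. \<theta> t \<in> equilibrium_surface M (lam t) (gam t)) \<and>
     (\<forall>t\<in>T. ((\<lambda>s. grad_J M (\<theta> s) (lam s) (gam s)) has_vector_derivative 0) (at t within T))"

end

theory Submission
  imports Defs
begin

text \<open>
  All derivatives are taken jointly in \<open>p = (\<theta>, \<lambda>, \<gamma>)\<close>. Dominated convergence allows differentiating
  under both integrals, first in \<open>z\<close> for fixed \<open>x\<close>, then in \<open>x\<close>. This yields
  \<open>\<nabla>\<^sub>\<theta> J = E\<langle>\<nabla>\<^sub>\<theta> H\<rangle>\<close>, and the derivative of this map in direction \<open>v\<close> is
  \<open>E[\<langle>D\<^sub>v \<nabla>\<^sub>\<theta> H\<rangle> - \<langle>D\<^sub>v H \<nabla>\<^sub>\<theta> H\<rangle> + \<langle>D\<^sub>v H\<rangle> \<langle>\<nabla>\<^sub>\<theta> H\<rangle>]\<close>, which contains the formulas for \<open>A\<close>, \<open>b\<^sub>\<lambda>\<close> and \<open>b\<^sub>\<gamma>\<close>.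
  Since only the continuity of the path is known, \<open>\<theta>\<close> is differentiated as in the implicit function
  theorem: \<open>\<nabla>\<^sub>\<theta> J\<close> changes by \<open>o(s - t)\<close> along the path, and invertibility of \<open>A\<close> bounds
  \<open>\<theta> s - \<theta> t\<close> first by \<open>O(s - t)\<close> and then determines its linear part.
  At an interior minimum \<open>A\<close> is symmetric and positive semidefinite, hence positive definite because
  it is invertible; by continuity of the Hessian it stays positive definite nearby, so that \<open>J\<close> is
  strictly convex there.
\<close>

subsection \<open>Gradients, Hessians and matrices\<close>

text \<open>Three obstacles shape the development. The derivative of a Gibbs average contains a
  product of two averages, while \<open>regular_near\<close> only puts the average of
  \<open>deriv_size\<close> below an integrable \<open>W\<close>; bounding both factors by
  \<open>W\<close> would give a square that need not be integrable. Since first derivatives enter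
  \<open>deriv_size\<close> squared, each factor is at most the square root of the averaged size,
  and the product is again below \<open>W\<close>. Next, measurability of the derivatives of the
  Hamiltonian is not part of the model; it is recovered from the Hamiltonian by limits of difference
  quotients. Finally, \<open>C2_on\<close> speaks of \<theta> at fixed multipliers. Joint
  differentiability comes from the affine dependence on the multipliers: everything is expressed by
  values at the pairs (0, 0), (1, 0), (0, 1). These need not lie near the current multipliers, and
  this is where the condition for all multipliers enters. Time is treated pointwise: at each instant
  the estimates live on a ball around the current triple, so radius and majorants may vary with
  time.\<close>

lemma grad_eq:
  assumes "GDERIV f x :> D"
  shows "grad f x = D"
  unfolding grad_def
proof (rule the_equality)
  fix E assume "GDERIV f x :> E"
  with assms have "(\<lambda>h. h \<bullet> D) = (\<lambda>h. h \<bullet> E)"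
    unfolding gderiv_def by (rule has_derivative_unique)
  then show "E = D"
    by (metis inner_commute vector_eq_ldot)
qed fact

lemma GDERIV_grad:
  fixes f :: "'a::euclidean_space \<Rightarrow> real"
  assumes "f differentiable (at x)"
  shows "GDERIV f x :> grad f x"
proof -
  from assms obtain f' where f': "(f has_derivative f') (at x)"
    by (auto simp: differentiable_def)
  then interpret bounded_linear f' by (rule has_derivative_bounded_linear)
  \<comment> \<open>Riesz representation: the adjoint of a functional, applied to the real number 1,
    is its representing vector.\<close>
  have "f' h = h \<bullet> adjoint f' 1" for h
    using adjoint_works[OF linear, of h 1] by simp
  then have "f' = (\<lambda>h. h \<bullet> adjoint f' 1)" by blast
  then have "GDERIV f x :> adjoint f' 1"
    using f' by (simp add: gderiv_def)
  then show ?thesis by (simp add: grad_eq)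
qed

lemma hess_has_derivative:
  fixes f :: "real^'n \<Rightarrow> real"
  assumes "grad f differentiable (at x)"
  shows "(grad f has_derivative (\<lambda>h. hess f x *v h)) (at x)"
  using assms jacobian_works unfolding hess_def by blast

lemma hess_eq:
  fixes f :: "real^'n \<Rightarrow> real"
  assumes "(grad f has_derivative (\<lambda>h. A *v h)) (at x)"
  shows "hess f x = A"
  unfolding hess_def jacobian_def
  using frechet_derivative_at[OF assms] by (metis matrix_of_matrix_vector_mul)

text \<open>The norm on matrices is the Euclidean norm of the row norms (Frobenius), so
  Cauchy-Schwarz in every row suffices. The same norm measures the Hessian in
  \<open>deriv_size\<close>.\<close>

lemma norm_matrix_vector_mult_le: "norm (A *v x) \<le> norm A * norm x"
  for A :: "real^'n^'m"
proof -
  have "norm (A *v x) = L2_set (\<lambda>i. \<bar>(A *v x) $ i\<bar>) UNIV"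
    by (simp add: norm_vec_def L2_set_def)
  also have "\<dots> \<le> L2_set (\<lambda>i. norm (A $ i) * norm x) UNIV"
    by (intro L2_set_mono) (auto simp: matrix_vector_mul_component Cauchy_Schwarz_ineq2)
  also have "\<dots> = norm A * norm x"
    by (simp add: norm_vec_def[of A] L2_set_left_distrib)
  finally show ?thesis .
qed

lemma bounded_linear_matrix_vector_mult_left: "bounded_linear (\<lambda>A::real^'n^'m. A *v x)"
proof (rule bounded_linear_intro[where K = "norm x"])
  show "norm (A *v x) \<le> norm A * norm x" for A :: "real^'n^'m"
    by (rule norm_matrix_vector_mult_le)
qed (auto simp: matrix_vector_mult_add_rdistrib scaleR_matrix_vector_assoc)

lemma outer_mult_vec: "outer u v *v h = (v \<bullet> h) *\<^sub>R u"
  by (simp add: outer_def matrix_vector_mult_def vec_eq_iff inner_vec_def sum_distrib_left mult_ac)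

lemma norm_outer: "norm (outer u v) = norm u * norm v"
proof -
  have "outer u v $ i = u $ i *\<^sub>R v" for i by (simp add: outer_def vec_eq_iff)
  then show ?thesis
    by (simp add: norm_vec_def[of "outer u v"] norm_vec_def[of u] L2_set_left_distrib)
qed

subsection \<open>Differentiability of solution paths\<close>

text \<open>The path is given, not constructed, so a left inverse \<open>B\<close> of the partial
  derivative and differentiability of \<open>\<Gamma>\<close> at a single point take the place of
  the implicit function theorem. Applying \<open>B\<close> to the expansion of
  \<open>\<Gamma>\<close> solves it for the increment of \<open>y\<close>. Continuity of
  \<open>y\<close> alone does not make the remainder \<open>o(s - t)\<close>, hence two
  passes.\<close>

lemma has_vector_derivative_implicit_path:
  fixes \<Gamma> :: "'a::real_normed_vector \<times> 'b::real_normed_vector \<Rightarrow> 'c::real_normed_vector"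
  assumes \<Gamma>: "(\<Gamma> has_derivative L) (at (y t, u t))"
    and B: "bounded_linear B" "\<And>h. B (L (h, 0)) = h"
    and y: "continuous (at t within T) y"
    and u: "(u has_vector_derivative u') (at t within T)"
    and comp: "((\<lambda>s. \<Gamma> (y s, u s)) has_vector_derivative 0) (at t within T)"
  shows "(y has_vector_derivative - B (L (0, u'))) (at t within T)"
proof -
  interpret L: bounded_linear L using \<Gamma> by (rule has_derivative_bounded_linear)
  interpret B: bounded_linear B by (fact B(1))
  define N where "N = at t within T"
  have u_cont: "continuous (at t within T) u"
    using u by (rule has_vector_derivative_continuous)
  have BL: "bounded_linear (\<lambda>k. B (L (0, k)))"
    by (intro bounded_linear_compose[OF B(1)] bounded_linear_compose[OF L.bounded_linear_axioms]
        bounded_linear_Pair bounded_linear_zero bounded_linear_ident)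
  obtain K1 where K1: "K1 > 0" "\<And>x. norm (B x) \<le> K1 * norm x"
    using B.pos_bounded by (metis mult.commute)
  obtain K2 where K2: "K2 > 0" "\<And>x. norm (B (L (0, x))) \<le> K2 * norm x"
    using bounded_linear.pos_bounded[OF BL] by (metis mult.commute)
  define K where "K = K1 + K2"
  have K: "K > 0" "norm (B x) \<le> K * norm x" "norm (B (L (0, k))) \<le> K * norm k" for x k
  proof -
    have "0 \<le> K2 * norm x" "0 \<le> K1 * norm k" using K1 K2 by simp_all
    then show "K > 0" "norm (B x) \<le> K * norm x" "norm (B (L (0, k))) \<le> K * norm k"
      using K1(1) K2(1) K1(2)[of x] K2(2)[of k] unfolding K_def distrib_right by linarith+
  qed
  \<comment> \<open>Apply \<open>B\<close> to the linear part of the expansion: the first argument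
    returns \<open>y s - y t\<close>, because \<open>B\<close> undoes
    \<open>L (h, 0)\<close>.\<close>
  have Y: "y s - y t = B (\<Gamma> (y s, u s) - \<Gamma> (y t, u t)) - B (L (0, u s - u t))
      - B (\<Gamma> (y s, u s) - \<Gamma> (y t, u t) - L (y s - y t, u s - u t))" for s
  proof -
    have "L (y s - y t, u s - u t) = L (y s - y t, 0) + L (0, u s - u t)"
      by (simp flip: L.add)
    then show ?thesis by (simp add: B.diff B.add B(2))
  qed
  have \<Gamma>_small: "\<forall>\<^sub>F s in N. norm (\<Gamma> (y s, u s) - \<Gamma> (y t, u t) - L (y s - y t, u s - u t))
      \<le> e * (norm (y s - y t) + norm (u s - u t))" if "e > 0" for e
  proof -
    \<comment> \<open>The punctured neighbourhood is filled in, since \<open>(y s, u s)\<close> may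
      return to \<open>(y t, u t)\<close> at other times; there both sides are 0.\<close>
    have "\<forall>\<^sub>F q in nhds (y t, u t). norm (\<Gamma> q - \<Gamma> (y t, u t) - L (q - (y t, u t)))
        \<le> e * norm (q - (y t, u t))"
      using \<Gamma> that unfolding has_derivative_within_alt2 eventually_at_filter
      by (auto elim!: allE[of _ e] eventually_mono)
    moreover have "((\<lambda>s. (y s, u s)) \<longlongrightarrow> (y t, u t)) N"
      using y u_cont unfolding N_def continuous_within by (rule tendsto_Pair)
    ultimately have "\<forall>\<^sub>F s in N. norm (\<Gamma> (y s, u s) - \<Gamma> (y t, u t) - L ((y s, u s) - (y t, u t)))
        \<le> e * norm ((y s, u s) - (y t, u t))"
      by (rule eventually_compose_filterlim)
    then show ?thesis
    proof eventually_elim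
      case (elim s)
      have "norm ((y s, u s) - (y t, u t)) \<le> norm (y s - y t) + norm (u s - u t)"
        by (simp add: norm_Pair sqrt_sum_squares_le_sum)
      with elim \<open>e > 0\<close> show ?case
        by (smt (verit) diff_Pair mult_left_mono)
    qed
  qed
  have u_small: "\<forall>\<^sub>F s in N. norm (u s - u t - (s - t) *\<^sub>R u') \<le> e * \<bar>s - t\<bar>" if "e > 0" for e
    using u that unfolding has_vector_derivative_def has_derivative_within_alt2 N_def by auto
  have c_small: "\<forall>\<^sub>F s in N. norm (\<Gamma> (y s, u s) - \<Gamma> (y t, u t)) \<le> e * \<bar>s - t\<bar>" if "e > 0" for e
    using comp that unfolding has_vector_derivative_def has_derivative_within_alt2 N_def by auto
  \<comment> \<open>Twice what remains once half of \<open>norm (y s - y t)\<close> is absorbed: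
    \<open>K\<close> for \<open>\<Gamma>\<close> with tolerance 1, \<open>K * (norm u' + 1)\<close>
    for the increment of \<open>u\<close>, and half of the bound on that increment.\<close>
  define C where "C = 2 * (K * (norm u' + 1) + K) + (norm u' + 1)"
  have u_lip: "\<forall>\<^sub>F s in N. norm (u s - u t) \<le> (norm u' + 1) * \<bar>s - t\<bar>"
    using u_small[OF zero_less_one]
  proof eventually_elim
    case (elim s)
    have "norm (u s - u t) \<le> norm (u s - u t - (s - t) *\<^sub>R u') + norm ((s - t) *\<^sub>R u')"
      by (metis diff_add_cancel norm_triangle_ineq)
    also have "\<dots> \<le> 1 * \<bar>s - t\<bar> + \<bar>s - t\<bar> * norm u'"
      using elim by (intro add_mono) auto
    finally show ?case by (simp add: algebra_simps)
  qed
  \<comment> \<open>The error term is first absorbed into the left-hand side to get a Lipschitz bound at \<open>t\<close>.\<close>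
  have half_K: "1 / (2 * K) > 0" using K(1) by simp
  have y_lip: "\<forall>\<^sub>F s in N. norm (y s - y t) \<le> C * \<bar>s - t\<bar>"
    using u_lip c_small[OF zero_less_one] \<Gamma>_small[OF half_K]
  proof eventually_elim
    case (elim s)
    let ?R = "\<Gamma> (y s, u s) - \<Gamma> (y t, u t) - L (y s - y t, u s - u t)"
    have "norm (y s - y t) \<le> norm (B (\<Gamma> (y s, u s) - \<Gamma> (y t, u t))) + norm (B (L (0, u s - u t)))
        + norm (B ?R)"
      by (subst Y) (smt (verit) norm_triangle_ineq4)
    also have "\<dots> \<le> K * (1 * \<bar>s - t\<bar>) + K * ((norm u' + 1) * \<bar>s - t\<bar>)
        + K * (1 / (2 * K) * (norm (y s - y t) + norm (u s - u t)))"
      using elim K by (intro add_mono order_trans[OF K(2)] order_trans[OF K(3)] mult_left_mono) auto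
    also have "K * (1 / (2 * K) * (norm (y s - y t) + norm (u s - u t)))
        = (norm (y s - y t) + norm (u s - u t)) / 2"
      using K(1) by simp
    finally have *: "norm (y s - y t) \<le> K * (1 * \<bar>s - t\<bar>) + K * ((norm u' + 1) * \<bar>s - t\<bar>)
        + (norm (y s - y t) + norm (u s - u t)) / 2" .
    have "norm (y s - y t) \<le> 4 * (K * \<bar>s - t\<bar>) + 2 * (K * (norm u' * \<bar>s - t\<bar>))
        + (norm u' * \<bar>s - t\<bar> + \<bar>s - t\<bar>)"
    proof -
      have absorb: "a \<le> 2 * X + Y + (a + b) / 2 \<Longrightarrow> b \<le> V + d \<Longrightarrow> a \<le> 4 * X + 2 * Y + (V + d)"
        for a b d V X Y :: real by (simp add: field_simps)
      show ?thesis
        using * elim(1) by (intro absorb) (simp_all add: distrib_left distrib_right)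
    qed
    also have "\<dots> = C * \<bar>s - t\<bar>" by (simp add: C_def algebra_simps)
    finally show ?case .
  qed
  have C: "C \<ge> 0" unfolding C_def using K by (auto intro!: add_nonneg_nonneg)
  \<comment> \<open>Three errors of relative size \<open>d\<close> pass through \<open>B\<close>:
    those of \<open>\<Gamma>\<close> along the path and of \<open>u\<close> count once, the
    remainder of \<open>\<Gamma>\<close> counts with the sum \<open>C + norm u' + 1\<close> of the
    Lipschitz constants of \<open>y\<close> and \<open>u\<close>.\<close>
  define E where "E = K * (1 + (C + norm u' + 1) + 1)"
  have E: "E > 0" unfolding E_def using K(1) C norm_ge_zero[of u'] by (intro mult_pos_pos) linarith+
  have main: "\<forall>\<^sub>F s in N. norm (y s - y t - (s - t) *\<^sub>R (- B (L (0, u')))) \<le> e * \<bar>s - t\<bar>"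
    if "e > 0" for e
  proof -
    define d where "d = e / E"
    have d: "d > 0" using that E by (simp add: d_def)
    show ?thesis
      using u_lip y_lip u_small[OF d] c_small[OF d] \<Gamma>_small[OF d]
    proof eventually_elim
      case (elim s)
      let ?R = "\<Gamma> (y s, u s) - \<Gamma> (y t, u t) - L (y s - y t, u s - u t)"
      have "y s - y t - (s - t) *\<^sub>R (- B (L (0, u')))
          = B (\<Gamma> (y s, u s) - \<Gamma> (y t, u t)) - B (L (0, u s - u t - (s - t) *\<^sub>R u')) - B ?R"
      proof -
        interpret BL: bounded_linear "\<lambda>k. B (L (0, k))" by (fact BL)
        show ?thesis by (subst Y) (simp add: BL.diff BL.scaleR)
      qed
      then have "norm (y s - y t - (s - t) *\<^sub>R (- B (L (0, u'))))
          \<le> norm (B (\<Gamma> (y s, u s) - \<Gamma> (y t, u t))) + norm (B (L (0, u s - u t - (s - t) *\<^sub>R u')))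
            + norm (B ?R)"
        by (smt (verit) norm_triangle_ineq4)
      also have "\<dots> \<le> K * (d * \<bar>s - t\<bar>) + K * (d * \<bar>s - t\<bar>)
          + K * (d * (norm (y s - y t) + norm (u s - u t)))"
        using elim K by (intro add_mono order_trans[OF K(2)] order_trans[OF K(3)] mult_left_mono) auto
      also have "\<dots> \<le> K * (d * \<bar>s - t\<bar>) + K * (d * \<bar>s - t\<bar>)
          + K * (d * (C * \<bar>s - t\<bar> + (norm u' + 1) * \<bar>s - t\<bar>))"
        using elim K d by (intro add_mono mult_left_mono) auto
      also have "\<dots> = (E * d) * \<bar>s - t\<bar>" by (simp add: E_def algebra_simps)
      finally show ?case using E by (simp add: d_def)
    qed
  qed
  show ?thesis
    unfolding has_vector_derivative_def has_derivative_within_alt2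
    using main unfolding N_def
    by (intro conjI allI impI bounded_linear_scaleR_left) (simp only: real_norm_def)
qed

subsection \<open>Second derivatives\<close>

text \<open>\<open>G\<close> is differentiable at \<open>x\<close> only, so continuity of second
  derivatives cannot be used. The second difference is an increment of a first difference; the mean
  value theorem turns it into a difference of two gradients, and only these are expanded at
  \<open>x\<close>.\<close>

lemma second_difference_asymp:
  fixes f :: "'a::euclidean_space \<Rightarrow> real"
  assumes "open S" "x \<in> S"
    and f: "\<And>y. y \<in> S \<Longrightarrow> GDERIV f y :> G y"
    and G: "(G has_derivative G') (at x)"
  shows "((\<lambda>s. (f (x + s *\<^sub>R h + s *\<^sub>R k) - f (x + s *\<^sub>R h) - f (x + s *\<^sub>R k) + f x) / s\<^sup>2)
           \<longlongrightarrow> h \<bullet> G' k) (at_right 0)"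
proof -
  interpret G': bounded_linear G' using G by (rule has_derivative_bounded_linear)
  obtain r where r: "r > 0" "ball x r \<subseteq> S"
    using assms(1,2) open_contains_ball by blast
  define m where "m = norm h + norm k + 1"
  have m: "m > 0" by (simp add: m_def add_nonneg_pos)
  let ?q = "\<lambda>s. (f (x + s *\<^sub>R h + s *\<^sub>R k) - f (x + s *\<^sub>R h) - f (x + s *\<^sub>R k) + f x) / s\<^sup>2"
  have "\<forall>\<^sub>F s in at_right 0. dist (?q s) (h \<bullet> G' k) < e" if "e > 0" for e
  proof -
    \<comment> \<open>Two gradient remainders, each at most \<open>d * (s * m)\<close>, are paired
      with \<open>h\<close>, whose norm is below \<open>m\<close>; after division by
      \<open>s\<close> the total is \<open>2 * m * d * m = e / 2\<close>.\<close>
    define d where "d = e / (4 * m * m)"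
    have d: "d > 0" using that m by (simp add: d_def)
    obtain \<delta> where \<delta>: "\<delta> > 0"
      "\<And>y. norm (y - x) < \<delta> \<Longrightarrow> norm (G y - G x - G' (y - x)) \<le> d * norm (y - x)"
      using G d unfolding has_derivative_at_alt by blast
    \<comment> \<open>For \<open>s\<close> below this value the whole parallelogram spanned at
      \<open>x\<close> stays inside \<open>S\<close> and within the range of the expansion of
      \<open>G\<close>.\<close>
    define \<rho> where "\<rho> = min r \<delta> / m"
    have \<rho>: "\<rho> > 0" using r \<delta> m by (simp add: \<rho>_def)
    have "dist (?q s) (h \<bullet> G' k) < e" if s: "0 < s" "s < \<rho>" for s
    proof -
      have sm: "s * m < min r \<delta>" using s m by (simp add: \<rho>_def field_simps)
      have le: "norm (u *\<^sub>R h + v *\<^sub>R k) \<le> s * m" if "0 \<le> u" "u \<le> s" "0 \<le> v" "v \<le> s" for u v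
      proof -
        have "norm (u *\<^sub>R h + v *\<^sub>R k) \<le> u * norm h + v * norm k"
          using that by (metis abs_of_nonneg norm_scaleR norm_triangle_ineq)
        also have "\<dots> \<le> s * norm h + s * norm k"
          using that by (intro add_mono mult_right_mono) auto
        finally show ?thesis using s by (simp add: m_def algebra_simps)
      qed
      have inS: "x + (u *\<^sub>R h + v *\<^sub>R k) \<in> S" if "0 \<le> u" "u \<le> s" "0 \<le> v" "v \<le> s" for u v
      proof (rule subsetD[OF r(2)])
        have "dist (x + (u *\<^sub>R h + v *\<^sub>R k)) x = norm (u *\<^sub>R h + v *\<^sub>R k)"
          by (simp add: dist_norm)
        then show "x + (u *\<^sub>R h + v *\<^sub>R k) \<in> ball x r"
          using le[OF that] sm by (simp add: dist_commute)
      qed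
      define \<phi> where "\<phi> u = f (x + (u *\<^sub>R h + s *\<^sub>R k)) - f (x + (u *\<^sub>R h + 0 *\<^sub>R k))" for u
      have der: "((\<lambda>u. f (x + (u *\<^sub>R h + v *\<^sub>R k))) has_real_derivative
          h \<bullet> G (x + (u *\<^sub>R h + v *\<^sub>R k))) (at u)" if "0 \<le> u" "u \<le> s" "0 \<le> v" "v \<le> s" for u v
      proof -
        have "((\<lambda>u. x + (u *\<^sub>R h + v *\<^sub>R k)) has_derivative (\<lambda>c. c *\<^sub>R h)) (at u)"
          by (auto intro!: derivative_eq_intros)
        from has_derivative_compose[OF this f[OF inS[OF that], unfolded gderiv_def]]
        show ?thesis by (simp add: has_field_derivative_def mult_commute_abs)
      qed
      have "\<exists>z. 0 < z \<and> z < s \<and> \<phi> s - \<phi> 0 = (s - 0) *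
          (h \<bullet> G (x + (z *\<^sub>R h + s *\<^sub>R k)) - h \<bullet> G (x + (z *\<^sub>R h + 0 *\<^sub>R k)))"
        unfolding \<phi>_def using s by (intro MVT2 DERIV_diff der) auto
      then obtain z where z: "0 < z" "z < s" and
        eq: "\<phi> s - \<phi> 0 = s * (h \<bullet> (G (x + (z *\<^sub>R h + s *\<^sub>R k)) - G (x + (z *\<^sub>R h + 0 *\<^sub>R k))))"
        by (auto simp: inner_diff_right)
      define R where "R v = G (x + (z *\<^sub>R h + v *\<^sub>R k)) - G x - G' (z *\<^sub>R h + v *\<^sub>R k)" for v
      have R: "norm (R v) \<le> d * (s * m)" if "0 \<le> v" "v \<le> s" for v
      proof -
        have "norm (R v) \<le> d * norm (z *\<^sub>R h + v *\<^sub>R k)"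
          using \<delta>(2)[of "x + (z *\<^sub>R h + v *\<^sub>R k)"] le[of z v] z that sm by (simp add: R_def)
        also have "\<dots> \<le> d * (s * m)" using le[of z v] z that d by (intro mult_left_mono) auto
        finally show ?thesis .
      qed
      have num: "\<phi> s - \<phi> 0 = s\<^sup>2 * (h \<bullet> G' k) + s * (h \<bullet> (R s - R 0))"
        unfolding eq by (simp add: R_def G'.add G'.scaleR G'.zero inner_add_right inner_diff_right
            power2_eq_square algebra_simps)
      have "?q s = (\<phi> s - \<phi> 0) / s\<^sup>2" by (simp add: \<phi>_def algebra_simps)
      then have "?q s - h \<bullet> G' k = (h \<bullet> (R s - R 0)) / s"
        unfolding num using s by (simp add: add_divide_distrib power2_eq_square)
      also have "\<bar>\<dots>\<bar> \<le> norm h * (d * (s * m) + d * (s * m)) / s"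
        unfolding abs_divide using s R[of s] R[of 0]
        by (intro divide_right_mono order_trans[OF Cauchy_Schwarz_ineq2] mult_left_mono
            order_trans[OF norm_triangle_ineq4] add_mono divide_mono) auto
      also have "\<dots> = 2 * norm h * d * m" using s by simp
      also have "\<dots> \<le> 2 * m * d * m" using d m by (intro mult_right_mono mult_left_mono) (auto simp: m_def)
      also have "\<dots> = e / 2" using m by (simp add: d_def)
      also have "\<dots> < e" using \<open>e > 0\<close> by simp
      finally show ?thesis by (simp add: dist_real_def)
    qed
    then show ?thesis
      unfolding eventually_at_right_field using \<rho> by blast
  qed
  then show ?thesis by (rule tendstoI)
qed

text \<open>The second difference does not change when \<open>h\<close> and \<open>k\<close> are
  exchanged, so its limit cannot either.\<close>

lemma symmetric_second_derivative:
  fixes f :: "'a::euclidean_space \<Rightarrow> real"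
  assumes "open S" "x \<in> S" "\<And>y. y \<in> S \<Longrightarrow> GDERIV f y :> G y" "(G has_derivative G') (at x)"
  shows "h \<bullet> G' k = k \<bullet> G' h"
proof (rule tendsto_unique[OF _ second_difference_asymp[OF assms] ])
  have "((\<lambda>s. (f (x + s *\<^sub>R k + s *\<^sub>R h) - f (x + s *\<^sub>R k) - f (x + s *\<^sub>R h) + f x) / s\<^sup>2)
           \<longlongrightarrow> k \<bullet> G' h) (at_right 0)"
    by (rule second_difference_asymp[OF assms])
  then show "((\<lambda>s. (f (x + s *\<^sub>R h + s *\<^sub>R k) - f (x + s *\<^sub>R h) - f (x + s *\<^sub>R k) + f x) / s\<^sup>2)
           \<longlongrightarrow> k \<bullet> G' h) (at_right 0)"
    by (simp add: algebra_simps)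
qed simp

text \<open>Otherwise the slope of \<open>f\<close> along the line in direction \<open>h\<close>,
  which is 0 at the minimum, is negative just to the right of it, and \<open>f\<close> drops below
  its minimum.\<close>

lemma second_derivative_nonneg_at_minimum:
  fixes f :: "'a::euclidean_space \<Rightarrow> real"
  assumes S: "open S" "x \<in> S" and f: "\<And>y. y \<in> S \<Longrightarrow> GDERIV f y :> G y"
    and G: "(G has_derivative G') (at x)" and min: "\<And>y. y \<in> S \<Longrightarrow> f x \<le> f y"
  shows "0 \<le> h \<bullet> G' h"
proof (rule ccontr)
  assume neg: "\<not> 0 \<le> h \<bullet> G' h"
  interpret G': bounded_linear G' using G by (rule has_derivative_bounded_linear)
  define l where "l s = x + s *\<^sub>R h" for s
  have l: "(l has_derivative (\<lambda>c. c *\<^sub>R h)) (at s)" for s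
    unfolding l_def by (auto intro!: derivative_eq_intros)
  have lc: "continuous_on UNIV l" unfolding l_def by (intro continuous_intros)
  have "open (l -` S)" using S(1) lc by (simp add: open_vimage)
  moreover have "0 \<in> l -` S" using S(2) by (simp add: l_def)
  ultimately obtain r where r: "r > 0" "ball 0 r \<subseteq> l -` S"
    using open_contains_ball by blast
  have fl: "((\<lambda>s. f (l s)) has_real_derivative h \<bullet> G (l s)) (at s)" if "\<bar>s\<bar> < r" for s
  proof -
    have "l s \<in> S" using r that by (auto simp: dist_real_def subset_iff)
    from has_derivative_compose[OF l f[OF this, unfolded gderiv_def]]
    show ?thesis by (simp add: has_field_derivative_def mult_commute_abs)
  qed
  have "h \<bullet> G (l 0) = 0"
  proof (rule DERIV_local_min[OF fl[of 0] r(1)])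
    show "\<forall>y. \<bar>0 - y\<bar> < r \<longrightarrow> f (l 0) \<le> f (l y)"
      using min r(2) by (auto simp: l_def dist_real_def subset_iff)
  qed (use r in auto)
  moreover have "((\<lambda>s. h \<bullet> G (l s)) has_real_derivative h \<bullet> G' h) (at 0)"
  proof -
    have "(G has_derivative G') (at (l 0))" using G by (simp add: l_def)
    from has_derivative_inner_right[OF has_derivative_compose[OF l this], of h]
    show ?thesis by (simp add: has_field_derivative_def G'.scaleR mult_commute_abs)
  qed
  ultimately obtain d where d: "d > 0" "\<And>s. 0 < s \<Longrightarrow> s < d \<Longrightarrow> h \<bullet> G (l s) < 0"
    using DERIV_neg_dec_right[of "\<lambda>s. h \<bullet> G (l s)" "h \<bullet> G' h" 0] neg by auto
  define s where "s = min d r / 2"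
  have s: "0 < s" "s < d" "s < r" using d r by (auto simp: s_def)
  have "f (l s) < f (l 0)"
  proof (rule DERIV_neg_imp_decreasing_open[of 0 s "\<lambda>s. f (l s)"])
    show "\<exists>y. ((\<lambda>s. f (l s)) has_real_derivative y) (at z) \<and> y < 0" if "0 < z" "z < s" for z
      using fl[of z] d(2)[of z] s that by fastforce
    show "continuous_on {0..s} (\<lambda>s. f (l s))"
      using s by (intro continuous_at_imp_continuous_on ballI DERIV_isCont[OF fl]) auto
  qed (use s in simp)
  moreover have "l s \<in> S" using r s by (auto simp: dist_real_def subset_iff)
  ultimately show False using min[of "l s"] by (simp add: l_def)
qed

text \<open>A semidefinite form vanishing at \<open>h\<close> has \<open>h\<close> in its kernel:
  moving from \<open>h\<close> in direction \<open>w = A *v h\<close> yields a nonnegative quadratic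
  in \<open>t\<close> without constant term, so its linear coefficient
  \<open>2 * (w \<bullet> w)\<close> is 0.\<close>

lemma positive_definite_if_invertible:
  fixes A :: "real^'n^'n"
  assumes sym: "\<And>h k. h \<bullet> (A *v k) = k \<bullet> (A *v h)"
    and psd: "\<And>h. 0 \<le> h \<bullet> (A *v h)" and inv: "invertible A" and "h \<noteq> 0"
  shows "0 < h \<bullet> (A *v h)"
proof (rule ccontr)
  assume "\<not> ?thesis"
  with psd[of h] have h0: "h \<bullet> (A *v h) = 0" by simp
  define w where "w = A *v h"
  have ineq: "0 \<le> 2 * t * (w \<bullet> w) + t * t * (w \<bullet> (A *v w))" for t
  proof -
    have "0 \<le> (h + t *\<^sub>R w) \<bullet> (A *v (h + t *\<^sub>R w))" by (rule psd)
    also have "\<dots> = 2 * t * (w \<bullet> w) + t * t * (w \<bullet> (A *v w))"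
      using h0 sym[of h w]
      by (simp add: matrix_vector_right_distrib matrix_vector_mult_scaleR inner_add_left
          inner_add_right w_def[symmetric] algebra_simps)
    finally show ?thesis .
  qed
  have "w \<bullet> w = 0"
  proof (rule ccontr)
    assume "w \<bullet> w \<noteq> 0"
    then have pos: "w \<bullet> w > 0" using inner_ge_zero[of w] by linarith
    define c where "c = w \<bullet> (A *v w)"
    have c: "c \<ge> 0" using psd by (simp add: c_def)
    \<comment> \<open>The quadratic is evaluated at \<open>t = - (w \<bullet> w) / (c + 1)\<close>;
      adding 1 to \<open>c\<close> keeps the denominator positive when \<open>c = 0\<close>.\<close>
    have "0 \<le> 2 * (- (w \<bullet> w) / (c + 1)) * (w \<bullet> w) + (- (w \<bullet> w) / (c + 1)) * (- (w \<bullet> w) / (c + 1)) * c"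
      using ineq unfolding c_def .
    also have "\<dots> = (w \<bullet> w)\<^sup>2 / (c + 1) * (c / (c + 1) - 2)"
      by (simp add: divide_inverse algebra_simps power2_eq_square)
    also have "\<dots> < 0"
      using c pos by (intro mult_pos_neg) (auto simp: field_simps)
    finally show False by simp
  qed
  then have "A *v h = 0" by (simp add: w_def)
  then have "h = 0" using inv
    by (metis matrix_left_invertible_ker invertible_left_inverse)
  with \<open>h \<noteq> 0\<close> show False by simp
qed

text \<open>On the compact unit sphere the form has a positive minimum \<open>c\<close>. A
  perturbation of the matrix of norm below \<open>c\<close> cannot destroy positivity there, and
  homogeneity extends it to all vectors.\<close>

lemma eventually_positive_definite:
  fixes A :: "'a::topological_space \<Rightarrow> real^'n^'n"
  assumes cont: "(A \<longlongrightarrow> A x) (nhds x)" and pd: "\<And>h. h \<noteq> 0 \<Longrightarrow> 0 < h \<bullet> (A x *v h)"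
  shows "\<forall>\<^sub>F y in nhds x. \<forall>h. h \<noteq> 0 \<longrightarrow> 0 < h \<bullet> (A y *v h)"
proof -
  have "compact (sphere (0::real^'n) 1)" by simp
  moreover have "sphere (0::real^'n) 1 \<noteq> {}" by simp
  moreover have "continuous_on (sphere 0 1) (\<lambda>h. h \<bullet> (A x *v h))"
    by (intro continuous_intros linear_continuous_on matrix_vector_mul_bounded_linear)
  ultimately obtain h0 where h0: "h0 \<in> sphere 0 1"
    "\<And>h. h \<in> sphere 0 1 \<Longrightarrow> h0 \<bullet> (A x *v h0) \<le> h \<bullet> (A x *v h)"
    using continuous_attains_inf[of "sphere 0 1" "\<lambda>h. h \<bullet> (A x *v h)"] by metis
  define c where "c = h0 \<bullet> (A x *v h0)"
  have c: "c > 0" unfolding c_def using h0(1) by (intro pd) auto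
  have "\<forall>\<^sub>F y in nhds x. dist (A y) (A x) < c"
    using cont c by (rule tendstoD)
  then show ?thesis
  proof eventually_elim
    case (elim y)
    have pos: "0 < h \<bullet> (A y *v h)" if h: "norm h = 1" for h
    proof -
      have "h \<bullet> (A x *v h) - h \<bullet> (A y *v h) = h \<bullet> ((A x - A y) *v h)"
        by (simp add: matrix_vector_mult_diff_rdistrib inner_diff_right)
      also have "\<dots> \<le> norm h * (norm (A x - A y) * norm h)"
        by (intro order_trans[OF norm_cauchy_schwarz] mult_left_mono norm_matrix_vector_mult_le) auto
      also have "\<dots> < c" using elim h by (simp add: dist_norm norm_minus_commute)
      also have "c \<le> h \<bullet> (A x *v h)" unfolding c_def using h h0(2) by simp
      finally show ?thesis by simp
    qed
    show ?case
    proof safe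
      fix h :: "real^'n" assume "h \<noteq> 0"
      then have "0 < (norm h)\<^sup>2 * (sgn h \<bullet> (A y *v sgn h))"
        by (intro mult_pos_pos pos) (auto simp: norm_sgn)
      also have "\<dots> = h \<bullet> (A y *v h)"
        using \<open>h \<noteq> 0\<close> by (simp add: sgn_div_norm matrix_vector_mult_scaleR power2_eq_square
          field_simps)
      finally show "0 < h \<bullet> (A y *v h)" .
    qed
  qed
qed

text \<open>The mean slopes on the two pieces of the segment are attained at some
  \<open>a < u < b\<close>, and positive curvature between these makes the slope at \<open>b\<close>
  strictly larger. Weighted by \<open>u * (1 - u)\<close>, the difference of the slopes is exactly
  the convexity gap.\<close>

lemma strictly_convex_on_second_derivative:
  fixes f :: "'a::euclidean_space \<Rightarrow> real"
  assumes S: "convex S" and f: "\<And>y. y \<in> S \<Longrightarrow> GDERIV f y :> G y"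
    and G: "\<And>y. y \<in> S \<Longrightarrow> (G has_derivative G' y) (at y)"
    and pd: "\<And>y h. y \<in> S \<Longrightarrow> h \<noteq> 0 \<Longrightarrow> 0 < h \<bullet> G' y h"
  shows "strictly_convex_on S f"
  unfolding strictly_convex_on_def
proof (intro conjI S ballI allI impI, elim conjE)
  fix x y u assume xy: "x \<in> S" "y \<in> S" "x \<noteq> y" and u: "0 < u" "u < (1::real)"
  define h where "h = y - x"
  define l where "l s = x + s *\<^sub>R h" for s
  have l: "(l has_derivative (\<lambda>c. c *\<^sub>R h)) (at s)" for s
    unfolding l_def by (auto intro!: derivative_eq_intros)
  have lS: "l s \<in> S" if "0 \<le> s" "s \<le> 1" for s
  proof -
    have "l s = (1 - s) *\<^sub>R x + s *\<^sub>R y" by (simp add: l_def h_def algebra_simps)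
    then show ?thesis using S xy that by (simp add: convexD)
  qed
  have d1: "((\<lambda>s. f (l s)) has_real_derivative h \<bullet> G (l s)) (at s)" if "0 \<le> s" "s \<le> 1" for s
    using has_derivative_compose[OF l f[OF lS[OF that], unfolded gderiv_def]]
    by (simp add: has_field_derivative_def mult_commute_abs)
  have d2: "((\<lambda>s. h \<bullet> G (l s)) has_real_derivative h \<bullet> G' (l s) h) (at s)" if "0 \<le> s" "s \<le> 1" for s
  proof -
    interpret G': bounded_linear "G' (l s)"
      using G[OF lS[OF that]] by (rule has_derivative_bounded_linear)
    show ?thesis
      using has_derivative_inner_right[OF has_derivative_compose[OF l G[OF lS[OF that]]], of h]
      by (simp add: has_field_derivative_def G'.scaleR mult_commute_abs)
  qed
  obtain a where a: "0 < a" "a < u" "f (l u) - f (l 0) = (u - 0) * (h \<bullet> G (l a))"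
    using MVT2[of 0 u "\<lambda>s. f (l s)" "\<lambda>s. h \<bullet> G (l s)"] d1 u by auto
  obtain b where b: "u < b" "b < 1" "f (l 1) - f (l u) = (1 - u) * (h \<bullet> G (l b))"
    using MVT2[of u 1 "\<lambda>s. f (l s)" "\<lambda>s. h \<bullet> G (l s)"] d1 u by auto
  obtain c where c: "a < c" "c < b" "h \<bullet> G (l b) - h \<bullet> G (l a) = (b - a) * (h \<bullet> G' (l c) h)"
    using MVT2[of a b "\<lambda>s. h \<bullet> G (l s)" "\<lambda>s. h \<bullet> G' (l s) h"] d2 a b by fastforce
  have "0 < h \<bullet> G' (l c) h" using a b c u xy by (intro pd lS) (auto simp: h_def)
  then have "0 < h \<bullet> G (l b) - h \<bullet> G (l a)" unfolding c(3) using a b by simp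
  then have "0 < u * (1 - u) * (h \<bullet> G (l b) - h \<bullet> G (l a))" using u by simp
  also have "\<dots> = u * (f (l 1) - f (l u)) - (1 - u) * (f (l u) - f (l 0))"
    unfolding a(3) b(3) by (simp add: algebra_simps)
  also have "\<dots> = (1 - u) * f (l 0) + u * f (l 1) - f (l u)" by (simp add: algebra_simps)
  finally have "f (l u) < (1 - u) * f (l 0) + u * f (l 1)" by simp
  moreover have "l 0 = x" "l 1 = y" "l u = (1 - u) *\<^sub>R x + u *\<^sub>R y"
    by (auto simp: l_def h_def algebra_simps)
  ultimately show "f ((1 - u) *\<^sub>R x + u *\<^sub>R y) < (1 - u) * f x + u * f y" by simp
qed

subsection \<open>Parameter-dependent integrals\<close>

text \<open>A directional derivative is a pointwise limit of difference quotients along one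
  sequence, and these are measurable. All measurability of derivatives of the Hamiltonian rests on
  this.\<close>

lemma borel_measurable_directional_derivative:
  fixes f :: "'p::real_normed_vector \<Rightarrow> 'z \<Rightarrow> 'b::{real_normed_vector, second_countable_topology}"
  assumes "open S" "p \<in> S"
    and meas: "\<And>q. q \<in> S \<Longrightarrow> f q \<in> borel_measurable N"
    and der: "\<And>z. z \<in> space N \<Longrightarrow> ((\<lambda>q. f q z) has_derivative f' z) (at p)"
  shows "(\<lambda>z. f' z v) \<in> borel_measurable N"
proof -
  have lim: "(\<lambda>n. p + inverse (real (Suc n)) *\<^sub>R v) \<longlonglongrightarrow> p + 0 *\<^sub>R v"
    by (intro tendsto_intros LIMSEQ_inverse_real_of_nat)
  then have "\<forall>\<^sub>F n in sequentially. p + inverse (real (Suc n)) *\<^sub>R v \<in> S"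
    using assms(1,2) by (auto dest: topological_tendstoD)
  then obtain K where K: "\<And>n. n \<ge> K \<Longrightarrow> p + inverse (real (Suc n)) *\<^sub>R v \<in> S"
    unfolding eventually_sequentially by blast
  \<comment> \<open>The shift by \<open>K\<close> keeps every evaluation point in \<open>S\<close>,
    where \<open>f\<close> is measurable.\<close>
  define t where "t n = inverse (real (Suc (n + K)))" for n
  have t0: "t n > 0" for n unfolding t_def by simp
  have t: "t \<longlonglongrightarrow> 0"
    unfolding t_def using LIMSEQ_inverse_real_of_nat by (rule LIMSEQ_ignore_initial_segment)
  show ?thesis
  proof (rule borel_measurable_LIMSEQ_metric)
    show "(\<lambda>z. (f (p + t n *\<^sub>R v) z - f p z) /\<^sub>R t n) \<in> borel_measurable N" for n
      using K[of "n + K"] assms(2)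
      by (intro borel_measurable_scaleR borel_measurable_diff meas) (auto simp: t_def)
    fix z assume z: "z \<in> space N"
    interpret bounded_linear "f' z" using der[OF z] by (rule has_derivative_bounded_linear)
    have "((\<lambda>s. p + s *\<^sub>R v) has_derivative (\<lambda>c. c *\<^sub>R v)) (at 0)"
      by (auto intro!: derivative_eq_intros)
    from has_derivative_compose[OF this, of "\<lambda>q. f q z" "f' z"] der[OF z]
    have "((\<lambda>s. f (p + s *\<^sub>R v) z) has_derivative (\<lambda>c. f' z (c *\<^sub>R v))) (at 0)"
      by simp
    then have "((\<lambda>s. (f (p + s *\<^sub>R v) z - f p z - f' z (s *\<^sub>R v)) /\<^sub>R norm s) \<longlongrightarrow> 0) (at 0)"
      unfolding has_derivative_at_within by simp
    moreover have "filterlim t (at 0) sequentially"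
      using t t0 by (auto simp: filterlim_at less_imp_neq[symmetric])
    ultimately have "(\<lambda>n. (f (p + t n *\<^sub>R v) z - f p z - f' z (t n *\<^sub>R v)) /\<^sub>R norm (t n)) \<longlonglongrightarrow> 0"
      by (rule filterlim_compose)
    then have "(\<lambda>n. (f (p + t n *\<^sub>R v) z - f p z - f' z (t n *\<^sub>R v)) /\<^sub>R norm (t n) + f' z v) \<longlonglongrightarrow> 0 + f' z v"
      by (intro tendsto_intros)
    moreover have "(f (p + t n *\<^sub>R v) z - f p z - f' z (t n *\<^sub>R v)) /\<^sub>R norm (t n) + f' z v
        = (f (p + t n *\<^sub>R v) z - f p z) /\<^sub>R t n" for n
      using t0[of n] by (simp add: scaleR algebra_simps)
    ultimately show "(\<lambda>n. (f (p + t n *\<^sub>R v) z - f p z) /\<^sub>R t n) \<longlonglongrightarrow> f' z v"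
      by simp
  qed
qed

text \<open>One function \<open>w\<close> bounds the derivative on the convex set \<open>S\<close>,
  so the mean value inequality makes the integrand Lipschitz in the parameter with constant
  \<open>w z\<close>. This dominates the difference quotients and spreads integrability from the
  point \<open>p0\<close> to \<open>S\<close>. Both the integral over codes and the expectation over
  data are treated with it.\<close>

locale dominated_derivative =
  fixes N :: "'z measure" and S :: "'p::{real_normed_vector, perfect_space} set"
    and f :: "'p \<Rightarrow> 'z \<Rightarrow> 'b::{banach, second_countable_topology}"
    and f' :: "'p \<Rightarrow> 'z \<Rightarrow> 'p \<Rightarrow> 'b" and w :: "'z \<Rightarrow> real" and p0 :: 'p
  assumes S: "open S" "convex S"
    and meas: "\<And>q. q \<in> S \<Longrightarrow> f q \<in> borel_measurable N"
    and der: "\<And>q z. q \<in> S \<Longrightarrow> ((\<lambda>q. f q z) has_derivative f' q z) (at q)"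
    and bound: "\<And>q z v. q \<in> S \<Longrightarrow> norm (f' q z v) \<le> w z * norm v"
    and w: "integrable N w"
    and p0: "p0 \<in> S" "integrable N (f p0)"
begin

lemma lipschitz:
  assumes "p \<in> S" "q \<in> S"
  shows "norm (f q z - f p z) \<le> w z * norm (q - p)"
proof (rule differentiable_bound[OF S(2), where f' = "\<lambda>q. f' q z"])
  fix q assume q: "q \<in> S"
  show "((\<lambda>q. f q z) has_derivative f' q z) (at q within S)"
    using der[OF q] by (rule has_derivative_at_withinI)
  show "onorm (f' q z) \<le> w z" using bound[OF q] by (rule onorm_le)
qed (use assms in auto)

lemma integrable_param:
  assumes "p \<in> S"
  shows "integrable N (f p)"
proof -
  have "integrable N (\<lambda>z. f p z - f p0 z)"
  proof (rule Bochner_Integration.integrable_bound)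
    show "integrable N (\<lambda>z. w z * norm (p - p0))" using w by simp
    show "AE z in N. norm (f p z - f p0 z) \<le> norm (w z * norm (p - p0))"
      using lipschitz[OF p0(1) assms] by (intro AE_I2) (metis abs_ge_self order_trans real_norm_def)
  qed (use meas assms p0 in auto)
  from Bochner_Integration.integrable_add[OF this p0(2)] show ?thesis by simp
qed

lemma measurable_derivative: "p \<in> S \<Longrightarrow> (\<lambda>z. f' p z v) \<in> borel_measurable N"
  using borel_measurable_directional_derivative[OF S(1) _ meas der] .

lemma integrable_derivative:
  assumes "p \<in> S"
  shows "integrable N (\<lambda>z. f' p z v)"
proof (rule Bochner_Integration.integrable_bound)
  show "integrable N (\<lambda>z. w z * norm v)" using w by simp
  show "AE z in N. norm (f' p z v) \<le> norm (w z * norm v)"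
    using bound[OF assms] by (intro AE_I2) (metis abs_ge_self order_trans real_norm_def)
qed (rule measurable_derivative[OF assms])

lemma has_derivative_integral_param:
  assumes p: "p \<in> S"
  shows "((\<lambda>q. \<integral>z. f q z \<partial>N) has_derivative (\<lambda>v. \<integral>z. f' p z v \<partial>N)) (at p)"
proof -
  have lin: "linear (f' p z)" for z
    using der[OF p] by (rule has_derivative_linear)
  define L where "L v = (\<integral>z. f' p z v \<partial>N)" for v
  have "bounded_linear L"
  proof (rule bounded_linear_intro)
    show "L (u + v) = L u + L v" for u v
      unfolding L_def by (simp add: linear_add[OF lin] integrable_derivative[OF p])
    show "L (c *\<^sub>R v) = c *\<^sub>R L v" for c v
      unfolding L_def by (simp add: linear_scale[OF lin])
    show "norm (L v) \<le> norm v * (\<integral>z. w z \<partial>N)" for v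
    proof -
      have "norm (L v) \<le> (\<integral>z. norm (f' p z v) \<partial>N)" unfolding L_def by (rule integral_norm_bound)
      also have "\<dots> \<le> (\<integral>z. w z * norm v \<partial>N)"
        using bound[OF p] w integrable_derivative[OF p] by (intro integral_mono) auto
      finally show ?thesis by (simp add: mult.commute)
    qed
  qed
  moreover have "((\<lambda>q. ((\<integral>z. f q z \<partial>N) - (\<integral>z. f p z \<partial>N) - L (q - p)) /\<^sub>R norm (q - p))
      \<longlongrightarrow> 0) (at p within S)"
    \<comment> \<open>Dominated convergence speaks of sequences, so the limit is tested along an
      arbitrary one. The remainder quotient is below \<open>2 * w z\<close>: one \<open>w z\<close>
      for the Lipschitz bound, one for the linear part.\<close>
    unfolding tendsto_at_iff_sequentially o_def
  proof (intro allI impI)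
    fix X assume X: "\<forall>i. X i \<in> S - {p}" and lim: "X \<longlonglongrightarrow> p"
    have XS: "X i \<in> S" and Xp: "norm (X i - p) > 0" for i using X by auto
    define e where "e i z = (f (X i) z - f p z - f' p z (X i - p)) /\<^sub>R norm (X i - p)" for i z
    have "(\<lambda>i. \<integral>z. e i z \<partial>N) \<longlonglongrightarrow> (\<integral>z. 0 \<partial>N)"
    proof (rule integral_dominated_convergence[where w = "\<lambda>z. 2 * w z"])
      show "e i \<in> borel_measurable N" for i
        unfolding e_def using meas[OF XS] meas[OF p] measurable_derivative[OF p] by measurable
      show "AE z in N. norm (e i z) \<le> 2 * w z" for i
      proof (rule AE_I2)
        fix z
        have "norm (f (X i) z - f p z - f' p z (X i - p)) \<le> 2 * w z * norm (X i - p)"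
          using norm_triangle_ineq4[of "f (X i) z - f p z" "f' p z (X i - p)"]
            lipschitz[OF p XS[of i], of z] bound[OF p, of z "X i - p"] by simp
        then show "norm (e i z) \<le> 2 * w z"
          using Xp[of i] by (simp add: e_def divide_simps mult.commute)
      qed
      show "AE z in N. (\<lambda>i. e i z) \<longlonglongrightarrow> 0"
      proof (rule AE_I2)
        fix z
        have "((\<lambda>q. (f q z - f p z - f' p z (q - p)) /\<^sub>R norm (q - p)) \<longlongrightarrow> 0) (at p within S)"
          using der[OF p, THEN has_derivative_at_withinI] unfolding has_derivative_at_within by blast
        then show "(\<lambda>i. e i z) \<longlonglongrightarrow> 0"
          unfolding tendsto_at_iff_sequentially o_def e_def using X lim by blast
      qed
    qed (use w in auto)
    moreover have "(\<integral>z. e i z \<partial>N)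
        = ((\<integral>z. f (X i) z \<partial>N) - (\<integral>z. f p z \<partial>N) - L (X i - p)) /\<^sub>R norm (X i - p)" for i
      unfolding e_def L_def
      by (simp add: integrable_param XS p integrable_derivative[OF p])
    ultimately show "(\<lambda>i. ((\<integral>z. f (X i) z \<partial>N) - (\<integral>z. f p z \<partial>N) - L (X i - p)) /\<^sub>R norm (X i - p))
        \<longlonglongrightarrow> 0" by simp
  qed
  ultimately have "((\<lambda>q. \<integral>z. f q z \<partial>N) has_derivative L) (at p within S)"
    unfolding has_derivative_at_within by blast
  then show ?thesis
    unfolding L_def using at_within_open[OF p S(1)] by simp
qed

end

lemma continuous_on_integral_dominated:
  fixes f :: "'p::first_countable_topology \<Rightarrow> 'z \<Rightarrow> 'b::{banach, second_countable_topology}"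
  assumes meas: "\<And>q. q \<in> S \<Longrightarrow> f q \<in> borel_measurable N"
    and cont: "\<And>z. continuous_on S (\<lambda>q. f q z)"
    and bound: "\<And>q z. q \<in> S \<Longrightarrow> norm (f q z) \<le> w z" and w: "integrable N w"
  shows "continuous_on S (\<lambda>q. \<integral>z. f q z \<partial>N)"
proof -
  have "((\<lambda>q. \<integral>z. f q z \<partial>N) \<longlongrightarrow> (\<integral>z. f p z \<partial>N)) (at p within S)" if p: "p \<in> S" for p
    unfolding tendsto_at_iff_sequentially o_def
  proof (intro allI impI)
    fix X assume X: "\<forall>i. X i \<in> S - {p}" and lim: "X \<longlonglongrightarrow> p"
    show "(\<lambda>i. \<integral>z. f (X i) z \<partial>N) \<longlonglongrightarrow> (\<integral>z. f p z \<partial>N)"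
    proof (rule integral_dominated_convergence[where w = w])
      show "AE z in N. (\<lambda>i. f (X i) z) \<longlonglongrightarrow> f p z"
        using cont p X lim unfolding continuous_on_def tendsto_at_iff_sequentially o_def
        by (intro AE_I2) blast
    qed (use X meas bound w p in auto)
  qed
  then show ?thesis by (simp add: continuous_on_def)
qed

lemma borel_measurable_slice:
  assumes "(\<lambda>(x, z). f x z) \<in> borel_measurable (borel \<Otimes>\<^sub>M borel)"
  shows "f x \<in> borel_measurable borel"
proof -
  have "(\<lambda>z. (\<lambda>(x, z). f x z) (x, z)) \<in> borel_measurable borel"
    by (rule measurable_compose[OF _ assms]) simp
  then show ?thesis by simp
qed

subsection \<open>Gibbs averages of a smooth family of Hamiltonians\<close>

text \<open>The parameter \<open>p\<close> stands for the triple \<open>(\<theta>, \<lambda>, \<gamma>)\<close>; treating the three jointly gives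
  the Frechet derivative needed for the chain rule along a path.\<close>

locale gibbs_family = prob_space P for P :: "'x::euclidean_space measure" +
  fixes S :: "'p::euclidean_space set"
    and H :: "'p \<Rightarrow> 'x \<Rightarrow> 'z::euclidean_space \<Rightarrow> real"
    and H' :: "'p \<Rightarrow> 'x \<Rightarrow> 'z \<Rightarrow> 'p \<Rightarrow> real"
    and D :: "'p \<Rightarrow> 'x \<Rightarrow> 'z \<Rightarrow> real"
    and w :: "'x \<Rightarrow> 'z \<Rightarrow> real" and W :: "'x \<Rightarrow> real"
  assumes sets_P: "sets P = sets borel"
    and S: "open S" "convex S"
    and H_meas: "\<And>p. p \<in> S \<Longrightarrow> (\<lambda>(x, z). H p x z) \<in> borel_measurable (borel \<Otimes>\<^sub>M borel)"
    and D_meas: "\<And>p. p \<in> S \<Longrightarrow> (\<lambda>(x, z). D p x z) \<in> borel_measurable (borel \<Otimes>\<^sub>M borel)"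
    and H_der: "\<And>p x z. p \<in> S \<Longrightarrow> ((\<lambda>p. H p x z) has_derivative H' p x z) (at p)"
    and D_ge: "\<And>p x z. p \<in> S \<Longrightarrow> 1 \<le> D p x z"
    and H'_bound: "\<And>p x z v. p \<in> S \<Longrightarrow> (H' p x z v)\<^sup>2 \<le> D p x z * (norm v)\<^sup>2"
    and w: "\<And>x. integrable lborel (w x)" "\<And>p x z. p \<in> S \<Longrightarrow> exp (- H p x z) * D p x z \<le> w x z"
    and W: "integrable P W" "\<And>p x. p \<in> S \<Longrightarrow> gibbs_avg (H p x) (D p x) \<le> W x"
begin

abbreviation avg :: "'p \<Rightarrow> 'x \<Rightarrow> ('x \<Rightarrow> 'z \<Rightarrow> 'b::{banach, second_countable_topology}) \<Rightarrow> 'b" where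
  "avg p x \<phi> \<equiv> gibbs_avg (H p x) (\<phi> x)"

definition Z :: "'p \<Rightarrow> 'x \<Rightarrow> real" where
  "Z p x = (\<integral>z. exp (- H p x z) \<partial>lborel)"

text \<open>Observables of size \<open>O(D)\<close> are those which both majorants cover,
  \<open>w\<close> before and \<open>W\<close> after averaging. Joint measurability in
  \<open>x\<close> and \<open>z\<close> makes averages measurable in \<open>x\<close>; the constant
  is explicit because continuity in \<open>p\<close> needs it uniform.\<close>

definition dominated :: "real \<Rightarrow> 'p \<Rightarrow> ('x \<Rightarrow> 'z \<Rightarrow> 'b::{banach, second_countable_topology}) \<Rightarrow> bool" where
  "dominated C p \<phi> \<longleftrightarrow> (\<lambda>(x, z). \<phi> x z) \<in> borel_measurable (borel \<Otimes>\<^sub>M borel) \<and>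
     (\<forall>x z. norm (\<phi> x z) \<le> C * D p x z)"

lemma dominated_nonneg:
  assumes "dominated C p \<phi>" "p \<in> S"
  shows "0 \<le> C"
proof -
  have "0 \<le> norm (\<phi> x z)" "norm (\<phi> x z) \<le> C * D p x z" "1 \<le> D p x z" for x z
    using assms D_ge by (auto simp: dominated_def)
  then have "0 \<le> C * D p undefined undefined" "0 < D p undefined undefined"
    by (blast intro: order_trans, meson less_le_trans zero_less_one)
  then show ?thesis by (simp add: zero_le_mult_iff)
qed

lemma weight_meas:
  "p \<in> S \<Longrightarrow> (\<lambda>(x, z). exp (- H p x z)) \<in> borel_measurable (borel \<Otimes>\<^sub>M borel)"
  using H_meas[of p] by (simp add: case_prod_beta')

lemma integrable_dominated:
  assumes p: "p \<in> S" and \<phi>: "dominated C p \<phi>"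
  shows "integrable lborel (\<lambda>z. exp (- H p x z) *\<^sub>R \<phi> x z)"
proof (rule Bochner_Integration.integrable_bound)
  show "integrable lborel (\<lambda>z. C * w x z)" using w(1) by simp
  have "(\<lambda>z. exp (- H p x z)) \<in> borel_measurable borel"
    using borel_measurable_slice[OF weight_meas[OF p]] .
  moreover have "\<phi> x \<in> borel_measurable borel"
    using \<phi> borel_measurable_slice unfolding dominated_def by blast
  ultimately show "(\<lambda>z. exp (- H p x z) *\<^sub>R \<phi> x z) \<in> borel_measurable lborel" by simp
  show "AE z in lborel. norm (exp (- H p x z) *\<^sub>R \<phi> x z) \<le> norm (C * w x z)"
  proof (rule AE_I2)
    fix z
    have "norm (exp (- H p x z) *\<^sub>R \<phi> x z) \<le> exp (- H p x z) * (C * D p x z)"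
      using \<phi> unfolding dominated_def by simp
    also have "\<dots> = C * (exp (- H p x z) * D p x z)" by simp
    also have "\<dots> \<le> C * w x z"
      using w(2)[OF p] dominated_nonneg[OF \<phi> p] by (intro mult_left_mono)
    finally show "norm (exp (- H p x z) *\<^sub>R \<phi> x z) \<le> norm (C * w x z)" by simp
  qed
qed

lemma dominated_one: "p \<in> S \<Longrightarrow> dominated 1 p (\<lambda>_ _. 1 :: real)"
  using D_ge by (simp add: dominated_def)

lemma dominated_D: "p \<in> S \<Longrightarrow> dominated 1 p (D p)"
  using D_ge[of p] D_meas by (simp add: dominated_def) (meson order_trans zero_le_one)

lemma dominated_scaled_D:
  assumes "p \<in> S" "0 \<le> c"
  shows "dominated c p (\<lambda>x z. c * D p x z)"
  unfolding dominated_def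
proof (intro conjI allI)
  show "(\<lambda>(x, z). c * D p x z) \<in> borel_measurable (borel \<Otimes>\<^sub>M borel)"
    using D_meas[OF assms(1)] by (simp add: case_prod_beta')
  show "norm (c * D p x z) \<le> c * D p x z" for x z
    using assms(2) D_ge[OF assms(1), of x z] by (simp add: abs_mult)
qed

lemma dominated_const:
  fixes c :: real
  assumes "p \<in> S" "0 \<le> c"
  shows "dominated c p (\<lambda>x z. c)"
  using assms D_ge[OF assms(1)] by (auto simp: dominated_def intro: mult_left_mono[of 1 _ c, simplified])

lemma dominated_add:
  assumes "dominated B p \<phi>" "dominated C p \<psi>"
  shows "dominated (B + C) p (\<lambda>x z. \<phi> x z + \<psi> x z :: 'b::{banach, second_countable_topology})"
  using assms unfolding dominated_def
  by (auto simp: case_prod_beta' distrib_right intro!: order_trans[OF norm_triangle_ineq] add_mono)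

lemma integrable_weight: "p \<in> S \<Longrightarrow> integrable lborel (\<lambda>z. exp (- H p x z))"
  using integrable_dominated[OF _ dominated_one] by simp

text \<open>If the integral were 0, the exponential would vanish almost everywhere, which is
  impossible on a space of nonzero Lebesgue measure.\<close>

lemma Z_pos:
  assumes "p \<in> S"
  shows "0 < Z p x"
proof -
  have "Z p x \<noteq> 0"
  proof
    assume "Z p x = 0"
    then have "AE z in lborel. exp (- H p x z) = 0"
      unfolding Z_def using integral_nonneg_eq_0_iff_AE[OF integrable_weight[OF assms]] by simp
    then have "AE z in (lborel :: 'z measure). False" by simp
    then show False by (simp add: AE_iff_null null_sets_def emeasure_lborel_UNIV)
  qed
  moreover have "0 \<le> Z p x" unfolding Z_def by simp
  ultimately show ?thesis by simp
qed

lemma avg_alt: "gibbs_avg (H p x) \<psi> = (\<integral>z. exp (- H p x z) *\<^sub>R \<psi> z \<partial>lborel) /\<^sub>R Z p x"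
  by (simp add: gibbs_avg_def Z_def)

lemma avg_add:
  assumes "p \<in> S" "dominated B p \<phi>" "dominated C p \<psi>"
  shows "avg p x (\<lambda>x z. \<phi> x z + \<psi> x z) = avg p x \<phi> + avg p x \<psi>"
  using integrable_dominated[OF assms(1,2)] integrable_dominated[OF assms(1,3)]
  by (simp add: gibbs_avg_def scaleR_add_right)

lemma avg_bounded_linear:
  assumes "bounded_linear T" "p \<in> S" "dominated C p \<phi>"
  shows "avg p x (\<lambda>x z. T (\<phi> x z)) = T (avg p x \<phi>)"
proof -
  interpret T: bounded_linear T by fact
  show ?thesis
    using integral_bounded_linear[OF assms(1) integrable_dominated[OF assms(2,3)]]
    by (simp add: gibbs_avg_def T.scaleR)
qed

lemma avg_one: "p \<in> S \<Longrightarrow> avg p x (\<lambda>_ _. 1 :: real) = 1"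
  using Z_pos[of p x] by (simp add: avg_alt flip: Z_def)

lemma avg_mono:
  fixes \<phi> \<psi> :: "'x \<Rightarrow> 'z \<Rightarrow> real"
  assumes "p \<in> S" "dominated B p \<phi>" "dominated C p \<psi>" "\<And>z. \<phi> x z \<le> \<psi> x z"
  shows "avg p x \<phi> \<le> avg p x \<psi>"
  unfolding avg_alt using assms Z_pos[of p x]
    integrable_dominated[OF assms(1,2)] integrable_dominated[OF assms(1,3)]
  by (intro scaleR_left_mono integral_mono) (auto intro: mult_left_mono)

lemma norm_avg_le:
  assumes p: "p \<in> S" and \<phi>: "dominated C p \<phi>"
  shows "norm (avg p x \<phi>) \<le> avg p x (\<lambda>x z. norm (\<phi> x z))"
  unfolding avg_alt using Z_pos[OF p, of x]
  by (auto intro!: mult_left_mono order_trans[OF integral_norm_bound])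

lemma dominated_norm: "dominated C p \<phi> \<Longrightarrow> dominated C p (\<lambda>x z. norm (\<phi> x z))"
  by (auto simp: dominated_def case_prod_beta')

lemma norm_avg_le_D:
  assumes p: "p \<in> S" and \<phi>: "dominated C p \<phi>"
  shows "norm (avg p x \<phi>) \<le> C * avg p x (D p)"
proof -
  have "norm (avg p x \<phi>) \<le> avg p x (\<lambda>x z. norm (\<phi> x z))" using assms by (rule norm_avg_le)
  also have "\<dots> \<le> avg p x (\<lambda>x z. C * D p x z)"
    using \<phi> by (intro avg_mono[OF p dominated_norm[OF \<phi>] dominated_scaled_D[OF p dominated_nonneg[OF \<phi> p]]]) (simp add: dominated_def)
  also have "\<dots> = C * avg p x (D p)"
    using avg_bounded_linear[OF bounded_linear_mult_right p dominated_D[OF p]] .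
  finally show ?thesis .
qed

lemma norm_avg_le_W:
  assumes p: "p \<in> S" and \<phi>: "dominated C p \<phi>"
  shows "norm (avg p x \<phi>) \<le> C * W x"
  by (rule order_trans[OF norm_avg_le_D[OF assms] mult_left_mono[OF W(2)[OF p] dominated_nonneg[OF \<phi> p]]])

lemma avg_D_ge: "p \<in> S \<Longrightarrow> 1 \<le> avg p x (D p)"
  using avg_mono[OF _ dominated_one dominated_D, of p x] by (simp add: avg_one D_ge)

text \<open>Averaging \<open>|\<phi>| \<le> k (D / m + m) / 2\<close> with \<open>m\<^sup>2 = \<langle>D\<rangle>\<close> replaces Cauchy--Schwarz.\<close>

lemma norm_avg_le_sqrt:
  assumes p: "p \<in> S" and k: "0 \<le> k" and \<phi>: "dominated C p \<phi>"
    and sq: "\<And>z. (norm (\<phi> x z))\<^sup>2 \<le> D p x z * k\<^sup>2"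
  shows "norm (avg p x \<phi>) \<le> k * sqrt (avg p x (D p))"
proof -
  define m where "m = sqrt (avg p x (D p))"
  have m: "m > 0" "m * m = avg p x (D p)" using avg_D_ge[OF p, of x] by (auto simp: m_def)
  have "norm (\<phi> x z) \<le> k / 2 * (D p x z / m + m)" for z
  proof -
    have "norm (\<phi> x z) \<le> k * sqrt (D p x z)"
      using real_sqrt_le_mono[OF sq[of z]] k by (simp add: real_sqrt_mult mult.commute)
    also have "sqrt (D p x z) \<le> (D p x z / m + m) / 2"
    proof -
      have "0 \<le> (sqrt (D p x z) - m)\<^sup>2" by simp
      then have "2 * sqrt (D p x z) * m \<le> D p x z + m * m"
        using D_ge[OF p, of x z] by (simp add: power2_eq_square algebra_simps)
      then show ?thesis using m by (simp add: field_simps)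
    qed
    finally show ?thesis using k by (simp add: mult_left_mono)
  qed
  moreover have dom: "dominated (k / 2 * (1 / m)) p (\<lambda>x z. k / 2 * (1 / m) * D p x z)"
    "dominated (k / 2 * m) p (\<lambda>x z. k / 2 * m)"
    using k m by (intro dominated_scaled_D dominated_const p, simp)+
  ultimately have "avg p x (\<lambda>x z. norm (\<phi> x z))
      \<le> avg p x (\<lambda>x z. k / 2 * (1 / m) * D p x z + k / 2 * m)"
    by (intro avg_mono[OF p dominated_norm[OF \<phi>] dominated_add[OF dom]]) (auto simp: algebra_simps)
  also have "\<dots> = avg p x (\<lambda>x z. k / 2 * (1 / m) * D p x z) + avg p x (\<lambda>x z. (k / 2 * m) * 1)"
    using avg_add[OF p dom] by simp
  also have "\<dots> = k / 2 * (1 / m) * avg p x (D p) + (k / 2 * m) * 1"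
    unfolding avg_bounded_linear[OF bounded_linear_mult_right p dominated_D[OF p]]
      avg_bounded_linear[OF bounded_linear_mult_right p dominated_one[OF p]] avg_one[OF p] ..
  also have "\<dots> = k * m" using m(1) by (simp flip: m(2))
  finally show ?thesis using norm_avg_le[OF p \<phi>, of x] by (simp add: m_def)
qed

lemma measurable_avg:
  assumes p: "p \<in> S" and \<phi>: "dominated C p \<phi>"
  shows "(\<lambda>x. avg p x \<phi>) \<in> borel_measurable P" "Z p \<in> borel_measurable P"
proof -
  have "(\<lambda>(x, z). exp (- H p x z) *\<^sub>R \<phi> x z) \<in> borel_measurable (borel \<Otimes>\<^sub>M borel)"
    using weight_meas[OF p] \<phi> by (auto simp: dominated_def case_prod_beta')
  then have "(\<lambda>(x, z). exp (- H p x z) *\<^sub>R \<phi> x z) \<in> borel_measurable (P \<Otimes>\<^sub>M lborel)"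
    by (simp cong: measurable_cong_sets sets_pair_measure_cong add: sets_P)
  then have "(\<lambda>x. \<integral>z. exp (- H p x z) *\<^sub>R \<phi> x z \<partial>lborel) \<in> borel_measurable P"
    by (rule lborel.borel_measurable_lebesgue_integral)
  moreover
  have "(\<lambda>(x, z). exp (- H p x z)) \<in> borel_measurable (P \<Otimes>\<^sub>M lborel)"
    using weight_meas[OF p] by (simp cong: measurable_cong_sets sets_pair_measure_cong add: sets_P)
  then show "Z p \<in> borel_measurable P"
    unfolding Z_def[abs_def] by (rule lborel.borel_measurable_lebesgue_integral)
  ultimately show "(\<lambda>x. avg p x \<phi>) \<in> borel_measurable P"
    unfolding avg_alt by simp
qed

lemma integrable_avg:
  assumes p: "p \<in> S" and \<phi>: "dominated C p \<phi>"
  shows "integrable P (\<lambda>x. avg p x \<phi>)"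
proof (rule Bochner_Integration.integrable_bound)
  show "integrable P (\<lambda>x. C * W x)" using W(1) by simp
  show "AE x in P. norm (avg p x \<phi>) \<le> norm (C * W x)"
    using norm_avg_le_W[OF assms] by (intro AE_I2) (metis abs_ge_self order_trans real_norm_def)
qed (rule measurable_avg[OF assms])

lemma continuous_on_avg:
  assumes \<phi>: "\<And>q. q \<in> S \<Longrightarrow> dominated C q (\<phi> q)"
    and cont: "\<And>z. continuous_on S (\<lambda>q. \<phi> q x z)"
  shows "continuous_on S (\<lambda>q. avg q x (\<phi> q))"
proof -
  have H_cont: "continuous_on S (\<lambda>q. H q x z)" for z
    using H_der by (meson differentiableI differentiable_at_withinI differentiable_imp_continuous_on
        differentiable_on_def)
  \<comment> \<open>Stated for an arbitrary observable because it is needed twice: for the numerator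
    and, with the constant 1, for the normalization \<open>Z\<close>.\<close>
  have int: "continuous_on S (\<lambda>q. \<integral>z. exp (- H q x z) *\<^sub>R \<psi> q x z \<partial>lborel)"
    if \<psi>: "\<And>q. q \<in> S \<Longrightarrow> dominated K q (\<psi> q)" and c: "\<And>z. continuous_on S (\<lambda>q. \<psi> q x z)"
    for \<psi> :: "'p \<Rightarrow> 'x \<Rightarrow> 'z \<Rightarrow> 'c::{banach, second_countable_topology}" and K
  proof (rule continuous_on_integral_dominated[where w = "\<lambda>z. K * w x z"])
    show "norm (exp (- H q x z) *\<^sub>R \<psi> q x z) \<le> K * w x z" if q: "q \<in> S" for q z
    proof -
      have "norm (exp (- H q x z) *\<^sub>R \<psi> q x z) \<le> exp (- H q x z) * (K * D q x z)"
        using \<psi>[OF q] unfolding dominated_def by simp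
      also have "\<dots> = K * (exp (- H q x z) * D q x z)" by simp
      also have "\<dots> \<le> K * w x z"
        using w(2)[OF q] dominated_nonneg[OF \<psi>[OF q] q] by (intro mult_left_mono)
      finally show ?thesis .
    qed
    show "(\<lambda>z. exp (- H q x z) *\<^sub>R \<psi> q x z) \<in> borel_measurable lborel" if "q \<in> S" for q
      using integrable_dominated[OF that \<psi>[OF that]] by (rule borel_measurable_integrable)
  qed (use w c H_cont in \<open>auto intro!: continuous_intros\<close>)
  have "continuous_on S (\<lambda>q. Z q x)"
    unfolding Z_def using int[of 1 "\<lambda>_ _ _. 1 :: real"] dominated_one by simp
  moreover have "Z q x \<noteq> 0" if "q \<in> S" for q using Z_pos[OF that, of x] by simp
  ultimately show ?thesis
    unfolding avg_alt using int[OF \<phi> cont] by (intro continuous_intros) auto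
qed

lemma H'_le:
  assumes "p \<in> S"
  shows "\<bar>H' p x z v\<bar> \<le> sqrt (D p x z) * norm v"
  using real_sqrt_le_mono[OF H'_bound[OF assms, of x z v]] by (simp add: real_sqrt_mult)

lemma sqrt_D_le:
  assumes "p \<in> S"
  shows "sqrt (D p x z) \<le> D p x z"
  by (rule real_le_lsqrt) (use D_ge[OF assms, of x z] in \<open>auto simp: power2_eq_square\<close>)

lemma dominated_H':
  assumes p: "p \<in> S"
  shows "dominated (norm v) p (\<lambda>x z. H' p x z v)"
proof -
  have "(\<lambda>xz. H' p (fst xz) (snd xz) v) \<in> borel_measurable (borel \<Otimes>\<^sub>M borel)"
    using borel_measurable_directional_derivative[OF S(1) p, of "\<lambda>q xz. H q (fst xz) (snd xz)"
        "borel \<Otimes>\<^sub>M borel" "\<lambda>xz. H' p (fst xz) (snd xz)"] H_meas H_der[OF p]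
    by (simp add: case_prod_beta')
  moreover have "\<bar>H' p x z v\<bar> \<le> norm v * D p x z" for x z
    using H'_le[OF p] sqrt_D_le[OF p, of x z] 
    by (metis mult.commute mult_left_mono norm_ge_zero order_trans)
  ultimately show ?thesis by (simp add: dominated_def case_prod_beta')
qed

lemma has_derivative_weight:
  assumes "p \<in> S"
  shows "((\<lambda>q. exp (- H q x z)) has_derivative (\<lambda>v. - (exp (- H p x z) * H' p x z v))) (at p)"
  using H_der[OF assms] by (auto intro!: derivative_eq_intros)

text \<open>The factor \<open>Z p x\<close> is split off so that the derivative of
  \<open>ln Z\<close> becomes a plain Gibbs average.\<close>

lemma has_derivative_Z:
  assumes "p \<in> S"
  shows "((\<lambda>q. Z q x) has_derivative (\<lambda>v. - (Z p x * avg p x (\<lambda>x z. H' p x z v)))) (at p)"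
proof -
  interpret dominated_derivative lborel S "\<lambda>q z. exp (- H q x z)"
    "\<lambda>q z v. - (exp (- H q x z) * H' q x z v)" "w x" p
  proof
    fix q z v assume q: "q \<in> S"
    have "norm (- (exp (- H q x z) * H' q x z v)) \<le> exp (- H q x z) * (norm v * D q x z)"
      using dominated_H'[OF q, of v] by (simp add: dominated_def abs_mult)
    also have "\<dots> \<le> w x z * norm v"
      using w(2)[OF q, of x z] by (simp add: mult.left_commute mult.commute mult_left_mono)
    finally show "norm (- (exp (- H q x z) * H' q x z v)) \<le> w x z * norm v" .
  qed (use S w assms integrable_weight has_derivative_weight in \<open>auto dest: borel_measurable_integrable\<close>)
  show ?thesis
    using has_derivative_integral_param[OF assms] Z_pos[OF assms, of x] unfolding avg_alt
    by (simp add: Z_def[symmetric] mult.assoc[symmetric])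
qed

lemma has_derivative_ln_Z:
  assumes "p \<in> S"
  shows "((\<lambda>q. ln (Z q x)) has_derivative (\<lambda>v. - avg p x (\<lambda>x z. H' p x z v))) (at p)"
  using has_derivative_Z[OF assms] Z_pos[OF assms, of x]
  by (auto intro!: derivative_eq_intros simp: field_simps)

text \<open>The derivative of \<open>ln Z\<close> is bounded by \<open>W x * norm v\<close>
  throughout \<open>S\<close>, so finiteness of the expectation at \<open>p0\<close> carries over to
  all of \<open>S\<close>.\<close>

lemma has_derivative_expected_ln_Z:
  assumes p0: "p0 \<in> S" "integrable P (\<lambda>x. ln (Z p0 x))" and p: "p \<in> S"
  shows "((\<lambda>q. \<integral>x. ln (Z q x) \<partial>P) has_derivative (\<lambda>v. - (\<integral>x. avg p x (\<lambda>x z. H' p x z v) \<partial>P))) (at p)"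
proof -
  interpret dominated_derivative P S "\<lambda>q x. ln (Z q x)" "\<lambda>q x v. - avg q x (\<lambda>x z. H' q x z v)" W p0
  proof
    show "(\<lambda>x. ln (Z q x)) \<in> borel_measurable P" if "q \<in> S" for q
      using measurable_avg(2)[OF that dominated_one[OF that]] by simp
    show "norm (- avg q x (\<lambda>x z. H' q x z v)) \<le> W x * norm v" if "q \<in> S" for q x v
      using norm_avg_le_W[OF that dominated_H'[OF that]] by (simp add: mult.commute)
  qed (use S W p0 has_derivative_ln_Z in auto)
  show ?thesis using has_derivative_integral_param[OF p] by simp
qed

end

text \<open>\<open>Q\<close> will be the \<theta>-gradient of the Hamiltonian. As for
  \<open>H'\<close>, the bound by \<open>D\<close> is imposed on the square, so that the product of
  \<open>H'\<close> and \<open>Q\<close>, produced by differentiating the weight, is again of size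
  \<open>D\<close>.\<close>

locale gibbs_observable = gibbs_family P S H H' D w W
  for P :: "'x::euclidean_space measure" and S :: "'p::euclidean_space set"
    and H :: "'p \<Rightarrow> 'x \<Rightarrow> 'z::euclidean_space \<Rightarrow> real" and H' D w W +
  fixes Q :: "'p \<Rightarrow> 'x \<Rightarrow> 'z \<Rightarrow> 'b::euclidean_space"
    and Q' :: "'p \<Rightarrow> 'x \<Rightarrow> 'z \<Rightarrow> 'p \<Rightarrow> 'b"
  assumes Q_meas: "\<And>p. p \<in> S \<Longrightarrow> (\<lambda>(x, z). Q p x z) \<in> borel_measurable (borel \<Otimes>\<^sub>M borel)"
    and Q_der: "\<And>p x z. p \<in> S \<Longrightarrow> ((\<lambda>p. Q p x z) has_derivative Q' p x z) (at p)"
    and Q_bound: "\<And>p x z. p \<in> S \<Longrightarrow> (norm (Q p x z))\<^sup>2 \<le> D p x z"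
    and Q'_bound: "\<And>p x z v. p \<in> S \<Longrightarrow> norm (Q' p x z v) \<le> D p x z * norm v"
begin

text \<open>The quotient rule for a normalized average: mean derivative of \<open>Q\<close> minus
  the Gibbs covariance of \<open>Q\<close> with the directional derivative of \<open>H\<close>. For
  \<open>Q\<close> the gradient, the directions in \<theta>, \<lambda>, \<gamma> give the integrands
  of \<open>A_mat\<close> and, up to sign, of \<open>b_lam\<close> and \<open>b_gam\<close>.\<close>

definition avg' :: "'p \<Rightarrow> 'x \<Rightarrow> 'p \<Rightarrow> 'b" where
  "avg' p x v = avg p x (\<lambda>x z. Q' p x z v) - avg p x (\<lambda>x z. H' p x z v *\<^sub>R Q p x z)
     + avg p x (\<lambda>x z. H' p x z v) *\<^sub>R avg p x (Q p)"

lemma Q_le: "p \<in> S \<Longrightarrow> norm (Q p x z) \<le> sqrt (D p x z)"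
  using Q_bound by (simp add: real_le_rsqrt)

lemma dominated_Q: "p \<in> S \<Longrightarrow> dominated 1 p (Q p)"
  using Q_meas order_trans[OF Q_le sqrt_D_le] by (auto simp: dominated_def)

lemma dominated_Q':
  assumes p: "p \<in> S"
  shows "dominated (norm v) p (\<lambda>x z. Q' p x z v)"
proof -
  have "(\<lambda>xz. Q' p (fst xz) (snd xz) v) \<in> borel_measurable (borel \<Otimes>\<^sub>M borel)"
    using borel_measurable_directional_derivative[OF S(1) p, of "\<lambda>q xz. Q q (fst xz) (snd xz)"
        "borel \<Otimes>\<^sub>M borel" "\<lambda>xz. Q' p (fst xz) (snd xz)"] Q_meas Q_der[OF p]
    by (simp add: case_prod_beta')
  then show ?thesis using Q'_bound[OF p] by (simp add: dominated_def case_prod_beta' mult.commute)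
qed

lemma dominated_H'_Q:
  assumes p: "p \<in> S"
  shows "dominated (norm v) p (\<lambda>x z. H' p x z v *\<^sub>R Q p x z)"
proof -
  have "\<bar>H' p x z v\<bar> * norm (Q p x z) \<le> norm v * D p x z" for x z
  proof -
    have "\<bar>H' p x z v\<bar> * norm (Q p x z) \<le> (sqrt (D p x z) * norm v) * sqrt (D p x z)"
      using H'_le[OF p] Q_le[OF p] D_ge[OF p, of x z] by (intro mult_mono) auto
    then show ?thesis using D_ge[OF p, of x z] by (simp add: mult_ac)
  qed
  then show ?thesis
    using dominated_H'[OF p, of v] Q_meas[OF p] by (auto simp: dominated_def case_prod_beta')
qed

lemma has_derivative_avg:
  assumes p: "p \<in> S"
  shows "((\<lambda>q. avg q x (Q q)) has_derivative avg' p x) (at p)"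
proof -
  let ?f' = "\<lambda>q z v. exp (- H q x z) *\<^sub>R Q' q x z v - exp (- H q x z) *\<^sub>R (H' q x z v *\<^sub>R Q q x z)"
  \<comment> \<open>The product rule yields two terms, each at most \<open>w x z * norm v\<close>,
    whence the factor 2 in the majorant.\<close>
  interpret dominated_derivative lborel S "\<lambda>q z. exp (- H q x z) *\<^sub>R Q q x z" ?f' "\<lambda>z. 2 * w x z" p
  proof
    fix q z v assume q: "q \<in> S"
    show "((\<lambda>q. exp (- H q x z) *\<^sub>R Q q x z) has_derivative ?f' q z) (at q)"
      using has_derivative_scaleR[OF has_derivative_weight[OF q] Q_der[OF q], of x z x z]
      by (simp add: algebra_simps)
    have "norm (?f' q z v) \<le> exp (- H q x z) * norm (Q' q x z v)
        + exp (- H q x z) * norm (H' q x z v *\<^sub>R Q q x z)"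
      by (rule order_trans[OF norm_triangle_ineq4]) (simp add: abs_mult)
    also have "\<dots> \<le> exp (- H q x z) * (norm v * D q x z) + exp (- H q x z) * (norm v * D q x z)"
      using dominated_Q'[OF q, of v] dominated_H'_Q[OF q, of v]
      by (intro add_mono mult_left_mono) (auto simp: dominated_def)
    also have "\<dots> = 2 * (exp (- H q x z) * D q x z) * norm v" by simp
    also have "\<dots> \<le> 2 * w x z * norm v"
      using w(2)[OF q] by (intro mult_right_mono mult_left_mono) auto
    finally show "norm (?f' q z v) \<le> 2 * w x z * norm v" .
  qed (use S w p integrable_dominated[OF _ dominated_Q] in \<open>auto dest: borel_measurable_integrable\<close>)
  have Z: "Z p x > 0" using p by (rule Z_pos)
  have num: "(\<integral>z. ?f' p z v \<partial>lborel)
      = Z p x *\<^sub>R (avg p x (\<lambda>x z. Q' p x z v) - avg p x (\<lambda>x z. H' p x z v *\<^sub>R Q p x z))" for v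
    using integrable_dominated[OF p dominated_Q'[OF p], of x v]
      integrable_dominated[OF p dominated_H'_Q[OF p], of x v] Z
    by (simp add: avg_alt scaleR_diff_right)
  \<comment> \<open>Differentiating the factor \<open>inverse (Z q x)\<close> is what contributes
    the product of two averages, since the derivative of \<open>Z\<close> is \<open>- Z\<close>
    times an average.\<close>
  have "((\<lambda>q. inverse (Z q x) *\<^sub>R (\<integral>z. exp (- H q x z) *\<^sub>R Q q x z \<partial>lborel)) has_derivative
      (\<lambda>v. inverse (Z p x) *\<^sub>R (\<integral>z. ?f' p z v \<partial>lborel)
         + (- (inverse (Z p x) * (- (Z p x * avg p x (\<lambda>x z. H' p x z v))) * inverse (Z p x)))
             *\<^sub>R (\<integral>z. exp (- H p x z) *\<^sub>R Q p x z \<partial>lborel))) (at p)"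
    using Z by (intro has_derivative_scaleR Deriv.has_derivative_inverse has_derivative_Z
        has_derivative_integral_param p) auto
  moreover have "inverse (Z p x) *\<^sub>R (\<integral>z. ?f' p z v \<partial>lborel)
         + (- (inverse (Z p x) * (- (Z p x * avg p x (\<lambda>x z. H' p x z v))) * inverse (Z p x)))
             *\<^sub>R (\<integral>z. exp (- H p x z) *\<^sub>R Q p x z \<partial>lborel) = avg' p x v" for v
    unfolding num using Z by (simp add: avg'_def avg_alt[of p x "Q p x"])
  ultimately show ?thesis by (simp add: avg_alt)
qed

text \<open>One \<open>W x\<close> for each of the three terms. The product of averages is the
  delicate one: the square-root bound on both factors keeps it below
  \<open>norm v * avg p x (D p)\<close>, where the linear bound would produce the square of
  \<open>W x\<close>.\<close>

lemma norm_avg'_le: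
  assumes p: "p \<in> S"
  shows "norm (avg' p x v) \<le> 3 * W x * norm v"
proof -
  have "norm (avg p x (\<lambda>x z. H' p x z v)) \<le> norm v * sqrt (avg p x (D p))"
    using H'_bound[OF p] by (intro norm_avg_le_sqrt[OF p _ dominated_H'[OF p]]) auto
  moreover have "norm (avg p x (Q p)) \<le> 1 * sqrt (avg p x (D p))"
    using Q_bound[OF p] by (intro norm_avg_le_sqrt[OF p _ dominated_Q[OF p]]) auto
  ultimately have "norm (avg p x (\<lambda>x z. H' p x z v)) * norm (avg p x (Q p))
      \<le> (norm v * sqrt (avg p x (D p))) * (1 * sqrt (avg p x (D p)))"
    using avg_D_ge[OF p, of x] by (intro mult_mono) auto
  also have "\<dots> = norm v * avg p x (D p)" using avg_D_ge[OF p, of x] by simp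
  also have "\<dots> \<le> norm v * W x" using W(2)[OF p] by (intro mult_left_mono) auto
  finally have "norm (avg p x (\<lambda>x z. H' p x z v) *\<^sub>R avg p x (Q p)) \<le> norm v * W x" by simp
  then show ?thesis
    unfolding avg'_def
    using norm_avg_le_W[OF p dominated_Q'[OF p], of x v] norm_avg_le_W[OF p dominated_H'_Q[OF p], of x v]
      norm_triangle_ineq4[of "avg p x (\<lambda>x z. Q' p x z v)" "avg p x (\<lambda>x z. H' p x z v *\<^sub>R Q p x z)"]
      norm_triangle_ineq[of "avg p x (\<lambda>x z. Q' p x z v) - avg p x (\<lambda>x z. H' p x z v *\<^sub>R Q p x z)"
        "avg p x (\<lambda>x z. H' p x z v) *\<^sub>R avg p x (Q p)"]
    by (simp add: algebra_simps)
qed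

lemma dominated_derivative_avg:
  assumes "p0 \<in> S"
  shows "dominated_derivative P S (\<lambda>q x. avg q x (Q q)) avg' (\<lambda>x. 3 * W x) p0"
    by standard (use S W assms has_derivative_avg norm_avg'_le integrable_avg[OF _ dominated_Q]
        measurable_avg(1)[OF _ dominated_Q] in auto)

text \<open>Continuity passes through the code integrals with majorants \<open>w\<close> and then
  through the expectation with majorant \<open>3 * W\<close>. It serves the continuity of the
  Hessian of \<open>J\<close>, on which local strict convexity depends.\<close>

lemma continuous_on_expected_avg':
  assumes "\<And>x z. continuous_on S (\<lambda>q. Q' q x z v)" "\<And>x z. continuous_on S (\<lambda>q. H' q x z v)"
  shows "continuous_on S (\<lambda>q. \<integral>x. avg' q x v \<partial>P)"
proof (rule continuous_on_integral_dominated[where w = "\<lambda>x. 3 * W x * norm v"])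
  have "continuous_on S (\<lambda>q. Q q x z)" for x z
    using Q_der by (meson differentiableI differentiable_at_withinI differentiable_imp_continuous_on
        differentiable_on_def)
  then show "continuous_on S (\<lambda>q. avg' q x v)" for x
    unfolding avg'_def using assms
    by (intro continuous_intros continuous_on_avg[OF dominated_Q'] continuous_on_avg[OF dominated_Q]
        continuous_on_avg[OF dominated_H'] continuous_on_avg[OF dominated_H'_Q]) auto
qed (use W norm_avg'_le dominated_derivative.measurable_derivative[OF dominated_derivative_avg] in auto)

end

subsection \<open>The latent variable model\<close>

text \<open>Matrix entries are coordinates of images of basis vectors. Hessians and outer products
  are best accessible through their action on a direction, hence this criterion.\<close>

lemma borel_measurable_matrix:
  fixes F :: "'a \<Rightarrow> real^'n^'m"
  assumes "\<And>h. (\<lambda>x. F x *v h) \<in> borel_measurable N"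
  shows "F \<in> borel_measurable N"
  unfolding borel_measurable_euclidean_space[of F]
proof
  fix b :: "real^'n^'m" assume "b \<in> Basis"
  then obtain i j where b: "b = axis i (axis j 1)" by (auto simp: Basis_vec_def)
  have "F x \<bullet> b = (F x *v axis j 1) \<bullet> axis i 1" for x
    by (simp add: b inner_axis matrix_vector_mul_component)
  then show "(\<lambda>x. F x \<bullet> b) \<in> borel_measurable N"
    using borel_measurable_inner[OF assms borel_measurable_const] by simp
qed

text \<open>Fixes the witnesses behind the existential quantifiers of \<open>regular_near\<close>,
  with a radius for which the ball also lies in the parameter set. The center will be the state of
  the path at one instant.\<close>

locale regular_model =
  fixes M :: "('x::euclidean_space, 'y::countable, 'z::euclidean_space, 'n::finite) latent_model"
    and \<theta>0 :: "real^'n" and l0 g0 r :: real and w :: "'x \<Rightarrow> 'z \<Rightarrow> real" and W :: "'x \<Rightarrow> real"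
  assumes wf: "wf_model M" and r: "0 < r" and params: "ball \<theta>0 r \<subseteq> params M"
    and C2: "\<And>x z l g. C2_on (ball \<theta>0 r) (\<lambda>\<theta>. hamiltonian M z x \<theta> l g)"
    and w: "\<And>x. integrable lborel (w x)"
      "\<And>x \<theta> l g z. \<theta> \<in> ball \<theta>0 r \<Longrightarrow> l \<in> ball l0 r \<Longrightarrow> g \<in> ball g0 r \<Longrightarrow>
         exp (- hamiltonian M z x \<theta> l g) * deriv_size M x \<theta> l g z \<le> w x z"
    and W: "integrable (data_dist M) W"
      "\<And>x \<theta> l g. \<theta> \<in> ball \<theta>0 r \<Longrightarrow> l \<in> ball l0 r \<Longrightarrow> g \<in> ball g0 r \<Longrightarrow>
         gibbs_avg (\<lambda>z. hamiltonian M z x \<theta> l g) (deriv_size M x \<theta> l g) \<le> W x"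
    and fin: "J_finite M \<theta>0 l0 g0"
begin

text \<open>A ball in the product is open and convex, as the mean value inequality requires, and it
  lies in the product of the three balls of \<open>regular_near\<close>.\<close>

definition S :: "((real^'n) \<times> real \<times> real) set" where
  "S = ball (\<theta>0, l0, g0) r"

abbreviation \<HH> :: "(real^'n) \<times> real \<times> real \<Rightarrow> 'x \<Rightarrow> 'z \<Rightarrow> real" where
  "\<HH> \<equiv> \<lambda>p x z. hamiltonian M z x (fst p) (fst (snd p)) (snd (snd p))"

abbreviation \<GG> :: "(real^'n) \<times> real \<times> real \<Rightarrow> 'x \<Rightarrow> 'z \<Rightarrow> real^'n" where
  "\<GG> \<equiv> \<lambda>p x z. grad_H M z x (fst p) (fst (snd p)) (snd (snd p))"

abbreviation \<DD> :: "(real^'n) \<times> real \<times> real \<Rightarrow> 'x \<Rightarrow> 'z \<Rightarrow> real" where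
  "\<DD> \<equiv> \<lambda>p x z. deriv_size M x (fst p) (fst (snd p)) (snd (snd p)) z"

definition \<HH>' :: "(real^'n) \<times> real \<times> real \<Rightarrow> 'x \<Rightarrow> 'z \<Rightarrow> (real^'n) \<times> real \<times> real \<Rightarrow> real" where
  "\<HH>' p x z v = fst v \<bullet> \<GG> p x z
     + fst (snd v) * dlam_H M z x (fst p) (fst (snd p)) (snd (snd p))
     + snd (snd v) * dgam_H M z x (fst p) (fst (snd p)) (snd (snd p))"

definition \<GG>' :: "(real^'n) \<times> real \<times> real \<Rightarrow> 'x \<Rightarrow> 'z \<Rightarrow> (real^'n) \<times> real \<times> real \<Rightarrow> real^'n" where
  "\<GG>' p x z v = hess_H M z x (fst p) (fst (snd p)) (snd (snd p)) *v fst v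
     + fst (snd v) *\<^sub>R dlam_grad_H M z x (fst p) (fst (snd p)) (snd (snd p))
     + snd (snd v) *\<^sub>R dgam_grad_H M z x (fst p) (fst (snd p)) (snd (snd p))"

lemma S_open: "open S" and S_convex: "convex S" and center_in_S: "(\<theta>0, l0, g0) \<in> S"
  using r by (auto simp: S_def)

lemma in_S:
  assumes "p \<in> S"
  shows "fst p \<in> ball \<theta>0 r" "fst (snd p) \<in> ball l0 r" "snd (snd p) \<in> ball g0 r"
proof -
  have d: "dist (\<theta>0, l0, g0) p < r" using assms by (simp add: S_def)
  then show "fst p \<in> ball \<theta>0 r" using dist_fst_le[of "(\<theta>0, l0, g0)" p] by simp
  have "dist (l0, g0) (snd p) < r" using d dist_snd_le[of "(\<theta>0, l0, g0)" p] by simp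
  then show "fst (snd p) \<in> ball l0 r" "snd (snd p) \<in> ball g0 r"
    using dist_fst_le[of "(l0, g0)" "snd p"] dist_snd_le[of "(l0, g0)" "snd p"] by simp_all
qed

text \<open>Expressing the coefficients of \<open>l\<close> and \<open>g\<close> by values at fixed
  multipliers reduces joint regularity in the triple to regularity in \<theta>. The gradient and the
  Hessian inherit the same form.\<close>

lemma hamiltonian_affine:
  "hamiltonian M z x \<theta> l g = hamiltonian M z x \<theta> 0 0
     + l * (hamiltonian M z x \<theta> 1 0 - hamiltonian M z x \<theta> 0 0)
     + g * (hamiltonian M z x \<theta> 0 1 - hamiltonian M z x \<theta> 0 0)"
  by (simp add: hamiltonian_def algebra_simps)

lemma dlam_H_eq: "dlam_H M z x \<theta> l g = hamiltonian M z x \<theta> 1 0 - hamiltonian M z x \<theta> 0 0"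
  unfolding dlam_H_def
  by (rule DERIV_imp_deriv) (auto intro!: derivative_eq_intros simp: hamiltonian_def)

lemma dgam_H_eq: "dgam_H M z x \<theta> l g = hamiltonian M z x \<theta> 0 1 - hamiltonian M z x \<theta> 0 0"
  unfolding dgam_H_def hamiltonian_def
  by (rule DERIV_imp_deriv) (auto intro!: derivative_eq_intros)

lemma GDERIV_hamiltonian:
  "\<theta> \<in> ball \<theta>0 r \<Longrightarrow> GDERIV (\<lambda>\<theta>. hamiltonian M z x \<theta> l g) \<theta> :> grad_H M z x \<theta> l g"
  unfolding grad_H_def using C2[of z x l g] by (intro GDERIV_grad) (auto simp: C2_on_def)

lemma grad_H_has_derivative:
  assumes "\<theta> \<in> ball \<theta>0 r"
  shows "((\<lambda>\<theta>. grad_H M z x \<theta> l g) has_derivative (\<lambda>h. hess_H M z x \<theta> l g *v h)) (at \<theta>)"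
  using hess_has_derivative[of "\<lambda>\<theta>. hamiltonian M z x \<theta> l g" \<theta>] C2[of z x l g] assms
  unfolding grad_H_def[abs_def] hess_H_def by (auto simp: C2_on_def)

text \<open>Confined to the ball, because \<open>grad\<close> is a definite description and means
  something only where the Hamiltonian is differentiable.\<close>

lemma grad_H_affine:
  assumes "\<theta> \<in> ball \<theta>0 r"
  shows "grad_H M z x \<theta> l g = grad_H M z x \<theta> 0 0
     + l *\<^sub>R (grad_H M z x \<theta> 1 0 - grad_H M z x \<theta> 0 0)
     + g *\<^sub>R (grad_H M z x \<theta> 0 1 - grad_H M z x \<theta> 0 0)"
proof -
  note D = GDERIV_hamiltonian[OF assms, unfolded gderiv_def]
  have "((\<lambda>\<theta>. hamiltonian M z x \<theta> l g) has_derivative (\<lambda>h. h \<bullet> grad_H M z x \<theta> 0 0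
     + l * (h \<bullet> grad_H M z x \<theta> 1 0 - h \<bullet> grad_H M z x \<theta> 0 0)
     + g * (h \<bullet> grad_H M z x \<theta> 0 1 - h \<bullet> grad_H M z x \<theta> 0 0))) (at \<theta>)"
    by (subst hamiltonian_affine[abs_def])
      (intro has_derivative_add has_derivative_mult_right has_derivative_diff D)
  then show ?thesis
    unfolding grad_H_def[of M z x \<theta> l g]
    by (intro grad_eq) (simp add: gderiv_def inner_add_right inner_diff_right)
qed

lemma dlam_grad_H_eq:
  assumes "\<theta> \<in> ball \<theta>0 r"
  shows "dlam_grad_H M z x \<theta> l g = grad_H M z x \<theta> 1 0 - grad_H M z x \<theta> 0 0"
  unfolding dlam_grad_H_def
  by (rule vector_derivative_at, subst grad_H_affine[OF assms, abs_def])
    (auto intro!: derivative_eq_intros)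

lemma dgam_grad_H_eq:
  assumes "\<theta> \<in> ball \<theta>0 r"
  shows "dgam_grad_H M z x \<theta> l g = grad_H M z x \<theta> 0 1 - grad_H M z x \<theta> 0 0"
  unfolding dgam_grad_H_def
  by (rule vector_derivative_at, subst grad_H_affine[OF assms, abs_def])
    (auto intro!: derivative_eq_intros)

lemma hess_H_affine:
  assumes "\<theta> \<in> ball \<theta>0 r"
  shows "hess_H M z x \<theta> l g = hess_H M z x \<theta> 0 0
     + l *\<^sub>R (hess_H M z x \<theta> 1 0 - hess_H M z x \<theta> 0 0)
     + g *\<^sub>R (hess_H M z x \<theta> 0 1 - hess_H M z x \<theta> 0 0)"
proof -
  let ?A = "hess_H M z x \<theta> 0 0 + l *\<^sub>R (hess_H M z x \<theta> 1 0 - hess_H M z x \<theta> 0 0)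
     + g *\<^sub>R (hess_H M z x \<theta> 0 1 - hess_H M z x \<theta> 0 0)"
  note D = grad_H_has_derivative[OF assms]
  have "((\<lambda>\<theta>. grad_H M z x \<theta> 0 0
     + l *\<^sub>R (grad_H M z x \<theta> 1 0 - grad_H M z x \<theta> 0 0)
     + g *\<^sub>R (grad_H M z x \<theta> 0 1 - grad_H M z x \<theta> 0 0)) has_derivative (\<lambda>h. hess_H M z x \<theta> 0 0 *v h
     + l *\<^sub>R (hess_H M z x \<theta> 1 0 *v h - hess_H M z x \<theta> 0 0 *v h)
     + g *\<^sub>R (hess_H M z x \<theta> 0 1 *v h - hess_H M z x \<theta> 0 0 *v h))) (at \<theta>)"
    by (intro has_derivative_add has_derivative_scaleR_right has_derivative_diff D)
  then have "((\<lambda>\<theta>. grad_H M z x \<theta> 0 0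
     + l *\<^sub>R (grad_H M z x \<theta> 1 0 - grad_H M z x \<theta> 0 0)
     + g *\<^sub>R (grad_H M z x \<theta> 0 1 - grad_H M z x \<theta> 0 0)) has_derivative (\<lambda>h. ?A *v h)) (at \<theta>)"
    by (simp add: matrix_vector_mult_add_rdistrib matrix_vector_mult_diff_rdistrib
        scaleR_matrix_vector_assoc[symmetric])
  then have "((\<lambda>\<theta>. grad_H M z x \<theta> l g) has_derivative (\<lambda>h. ?A *v h)) (at \<theta>)"
    \<comment> \<open>The affine formula for the gradient may be differentiated because it holds on
      an open set around \<open>\<theta>\<close>, not merely at the point.\<close>
    by (rule has_derivative_transform_within_open[OF _ open_ball assms]) (simp add: grad_H_affine[of _ z x l g])
  then show ?thesis
    unfolding hess_H_def[of M z x \<theta> l g] grad_H_def[abs_def] by (rule hess_eq)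
qed

lemma \<HH>_has_derivative:
  assumes p: "p \<in> S"
  shows "((\<lambda>p. \<HH> p x z) has_derivative \<HH>' p x z) (at p)"
proof -
  note D = has_derivative_compose[OF has_derivative_fst[OF has_derivative_ident]
      GDERIV_hamiltonian[OF in_S(1)[OF p], unfolded gderiv_def]]
  show ?thesis
    by (subst hamiltonian_affine[abs_def])
      (rule derivative_eq_intros D has_derivative_fst has_derivative_snd has_derivative_ident refl
       | simp add: fun_eq_iff \<HH>'_def dlam_H_eq dgam_H_eq inner_add_right inner_diff_right
           grad_H_affine[OF in_S(1)[OF p], of z x "fst (snd p)" "snd (snd p)"] algebra_simps)+
qed

lemma \<GG>_has_derivative:
  assumes p: "p \<in> S"
  shows "((\<lambda>p. \<GG> p x z) has_derivative \<GG>' p x z) (at p)"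
proof -
  note D = has_derivative_compose[OF has_derivative_fst[OF has_derivative_ident]
      grad_H_has_derivative[OF in_S(1)[OF p]]]
  have "((\<lambda>p. grad_H M z x (fst p) 0 0
     + fst (snd p) *\<^sub>R (grad_H M z x (fst p) 1 0 - grad_H M z x (fst p) 0 0)
     + snd (snd p) *\<^sub>R (grad_H M z x (fst p) 0 1 - grad_H M z x (fst p) 0 0))
     has_derivative \<GG>' p x z) (at p)"
    by (rule derivative_eq_intros D has_derivative_fst has_derivative_snd has_derivative_ident refl
       | simp add: fun_eq_iff \<GG>'_def dlam_grad_H_eq[OF in_S(1)[OF p]] dgam_grad_H_eq[OF in_S(1)[OF p]]
           hess_H_affine[OF in_S(1)[OF p], of z x "fst (snd p)" "snd (snd p)"]
           matrix_vector_mult_add_rdistrib matrix_vector_mult_diff_rdistrib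
           scaleR_matrix_vector_assoc[symmetric] algebra_simps)+
  then show ?thesis
    by (rule has_derivative_transform_within_open[OF _ S_open p])
      (use in_S(1) in \<open>simp add: grad_H_affine[of _ z x "fst (snd _)" "snd (snd _)"]\<close>)
qed

text \<open>Cauchy-Schwarz in the product space: \<open>\<HH>'\<close> pairs \<open>v\<close> with
  the full gradient in the triple, whose squared norm is the sum of the three squared terms in
  \<open>deriv_size\<close>.\<close>

lemma \<HH>'_bound: "(\<HH>' p x z v)\<^sup>2 \<le> \<DD> p x z * (norm v)\<^sup>2"
proof -
  let ?u = "(\<GG> p x z, dlam_H M z x (fst p) (fst (snd p)) (snd (snd p)),
    dgam_H M z x (fst p) (fst (snd p)) (snd (snd p)))"
  have "\<HH>' p x z v = v \<bullet> ?u" by (simp add: \<HH>'_def inner_prod_def)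
  then have "(\<HH>' p x z v)\<^sup>2 \<le> (v \<bullet> v) * (?u \<bullet> ?u)"
    by (metis Cauchy_Schwarz_ineq)
  also have "\<dots> = (?u \<bullet> ?u) * (norm v)\<^sup>2" by (simp add: power2_norm_eq_inner)
  also have "?u \<bullet> ?u \<le> \<DD> p x z"
    by (simp add: deriv_size_def inner_prod_def dot_square_norm power2_eq_square)
  finally show ?thesis by (simp add: mult_right_mono)
qed

lemma \<GG>'_bound: "norm (\<GG>' p x z v) \<le> \<DD> p x z * norm v"
proof -
  have f: "norm (fst v) \<le> norm v" "\<bar>fst (snd v)\<bar> \<le> norm v" "\<bar>snd (snd v)\<bar> \<le> norm v"
    using norm_fst_le[of "fst v" "snd v"] norm_snd_le[of "snd v" "fst v"]
      norm_fst_le[of "fst (snd v)" "snd (snd v)"] norm_snd_le[of "snd (snd v)" "fst (snd v)"]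
    by (simp_all del: norm_fst_le norm_snd_le)
  let ?h = "hess_H M z x (fst p) (fst (snd p)) (snd (snd p))"
  let ?l = "dlam_grad_H M z x (fst p) (fst (snd p)) (snd (snd p))"
  let ?g = "dgam_grad_H M z x (fst p) (fst (snd p)) (snd (snd p))"
  have "norm (\<GG>' p x z v) \<le> norm (?h *v fst v) + norm (fst (snd v) *\<^sub>R ?l) + norm (snd (snd v) *\<^sub>R ?g)"
    unfolding \<GG>'_def by (intro order_trans[OF norm_triangle_ineq] add_right_mono norm_triangle_ineq)
  also have "\<dots> \<le> norm ?h * norm v + norm v * norm ?l + norm v * norm ?g"
    using f by (intro add_mono order_trans[OF norm_matrix_vector_mult_le] mult_left_mono)
      (auto intro: mult_right_mono)
  also have "\<dots> = (norm ?h + norm ?l + norm ?g) * norm v" by (simp add: algebra_simps)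
  also have "\<dots> \<le> \<DD> p x z * norm v"
    by (intro mult_right_mono) (auto simp: deriv_size_def)
  finally show ?thesis .
qed

section \<open>Joint measurability in data and code\<close>

lemma \<HH>_measurable:
  assumes "p \<in> S"
  shows "(\<lambda>(x, z). \<HH> p x z) \<in> borel_measurable (borel \<Otimes>\<^sub>M borel)"
proof -
  have \<theta>: "fst p \<in> params M" using in_S(1)[OF assms] params by blast
  have prior [measurable]: "prior M (fst p) \<in> borel_measurable borel"
    using wf \<theta> by (simp add: wf_model_def)
  have dec: "(\<lambda>(z, x). decoder M (fst p) z x) \<in> borel_measurable (borel \<Otimes>\<^sub>M borel)"
    using wf \<theta> by (simp add: wf_model_def borel_prod)
  have dec' [measurable]: "(\<lambda>q. decoder M (fst p) (snd q) (fst q)) \<in> borel_measurable (borel \<Otimes>\<^sub>M borel)"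
    using measurable_compose[OF _ dec, of "\<lambda>q. (snd q, fst q)"] by simp
  have lab: "label M \<in> borel \<rightarrow>\<^sub>M count_space UNIV"
    using wf by (simp add: wf_model_def)
  have cls: "(\<lambda>z. pmf (classifier M (fst p) z) y) \<in> borel_measurable borel" for y
    using wf \<theta> by (simp add: wf_model_def)
  have cls' [measurable]: "(\<lambda>q. pmf (classifier M (fst p) (snd q)) (label M (fst q)))
      \<in> borel_measurable (borel \<Otimes>\<^sub>M borel)"
  \<comment> \<open>The label picks one of countably many functions of the code, each measurable;
    countability makes the composite jointly measurable.\<close>
  proof (rule measurable_compose_countable[where f = "\<lambda>y q. pmf (classifier M (fst p) (snd q)) y"])
    show "(\<lambda>q. pmf (classifier M (fst p) (snd q)) y) \<in> borel_measurable (borel \<Otimes>\<^sub>M borel)" for y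
      by (rule measurable_compose[OF measurable_snd cls])
    show "(\<lambda>q. label M (fst q)) \<in> borel \<Otimes>\<^sub>M borel \<rightarrow>\<^sub>M count_space UNIV"
      by (rule measurable_compose[OF measurable_fst lab])
  qed
  show ?thesis unfolding hamiltonian_def case_prod_beta' by measurable
qed

lemma \<HH>'_measurable:
  assumes "p \<in> S"
  shows "(\<lambda>q. \<HH>' p (fst q) (snd q) v) \<in> borel_measurable (borel \<Otimes>\<^sub>M borel)"
  using borel_measurable_directional_derivative[OF S_open assms, of "\<lambda>q xz. \<HH> q (fst xz) (snd xz)"
      "borel \<Otimes>\<^sub>M borel" "\<lambda>xz. \<HH>' p (fst xz) (snd xz)"] \<HH>_measurable \<HH>_has_derivative[OF assms]
  by (simp add: case_prod_beta')

text \<open>The coordinates of the gradient are directional derivatives of the Hamiltonian along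
  basis vectors of the \<theta>-space.\<close>

lemma \<GG>_measurable:
  assumes "p \<in> S"
  shows "(\<lambda>q. \<GG> p (fst q) (snd q)) \<in> borel_measurable (borel \<Otimes>\<^sub>M borel)"
  unfolding borel_measurable_euclidean_space[of "\<lambda>q. \<GG> p (fst q) (snd q)"]
  using \<HH>'_measurable[OF assms, of "(_, 0, 0)"] by (simp add: \<HH>'_def inner_commute)

lemma \<GG>'_measurable:
  assumes "p \<in> S"
  shows "(\<lambda>q. \<GG>' p (fst q) (snd q) v) \<in> borel_measurable (borel \<Otimes>\<^sub>M borel)"
  using borel_measurable_directional_derivative[OF S_open assms, of "\<lambda>q xz. \<GG> q (fst xz) (snd xz)"
      "borel \<Otimes>\<^sub>M borel" "\<lambda>xz. \<GG>' p (fst xz) (snd xz)"] \<GG>_measurable \<GG>_has_derivative[OF assms]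
  by (simp add: case_prod_beta')

lemma hess_H_measurable:
  assumes "p \<in> S"
  shows "(\<lambda>q. hess_H M (snd q) (fst q) (fst p) (fst (snd p)) (snd (snd p)))
     \<in> borel_measurable (borel \<Otimes>\<^sub>M borel)"
  using \<GG>'_measurable[OF assms, of "(_, 0, 0)"]
  by (intro borel_measurable_matrix) (simp add: \<GG>'_def)

lemma \<DD>_measurable:
  assumes "p \<in> S"
  shows "(\<lambda>(x, z). \<DD> p x z) \<in> borel_measurable (borel \<Otimes>\<^sub>M borel)"
  using \<HH>'_measurable[OF assms, of "(0, 1, 0)"] \<HH>'_measurable[OF assms, of "(0, 0, 1)"]
    \<GG>'_measurable[OF assms, of "(0, 1, 0)"] \<GG>'_measurable[OF assms, of "(0, 0, 1)"]
    \<GG>_measurable[OF assms] hess_H_measurable[OF assms]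
  unfolding deriv_size_def case_prod_beta'
  by (intro borel_measurable_add borel_measurable_power borel_measurable_norm borel_measurable_const)
    (simp_all add: \<HH>'_def \<GG>'_def)

sublocale gibbs_observable "data_dist M" S \<HH> \<HH>' \<DD> w W \<GG> \<GG>'
proof -
  interpret prob_space "data_dist M" using wf by (simp add: wf_model_def)
  interpret gibbs_family "data_dist M" S \<HH> \<HH>' \<DD> w W
  proof
    show "gibbs_avg (\<HH> p x) (\<DD> p x) \<le> W x" if "p \<in> S" for p x
      using W(2)[OF in_S[OF that], of x] .
    show "1 \<le> \<DD> p x z" for p x z by (simp add: deriv_size_def)
    show "sets (data_dist M) = sets borel" using wf by (simp add: wf_model_def)
    show "exp (- \<HH> p x z) * \<DD> p x z \<le> w x z" if "p \<in> S" for p x z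
      using w(2)[OF in_S[OF that]] .
    show "(\<HH>' p x z v)\<^sup>2 \<le> \<DD> p x z * (norm v)\<^sup>2" for p x z v by (rule \<HH>'_bound)
  qed (fact S_open S_convex \<HH>_measurable \<DD>_measurable \<HH>_has_derivative w(1) W(1))+
  show "gibbs_observable (data_dist M) S \<HH> \<HH>' \<DD> w W \<GG> \<GG>'"
  proof
    show "(\<lambda>(x, z). \<GG> p x z) \<in> borel_measurable (borel \<Otimes>\<^sub>M borel)" if "p \<in> S" for p
      using \<GG>_measurable[OF that] by (simp add: case_prod_beta')
    show "(norm (\<GG> p x z))\<^sup>2 \<le> \<DD> p x z" for p x z by (simp add: deriv_size_def)
    show "norm (\<GG>' p x z v) \<le> \<DD> p x z * norm v" for p x z v by (rule \<GG>'_bound)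
  qed (fact \<GG>_has_derivative)
qed

section \<open>The functional J and its derivatives\<close>

lemma Z_eq_partition_fn:
  assumes "p \<in> S"
  shows "Z p x = partition_fn M x (fst p) (fst (snd p)) (snd (snd p))"
proof -
  have "fst p \<in> params M" using in_S(1)[OF assms] params by blast
  then have pos: "0 < prior M (fst p) z" "0 < decoder M (fst p) z x"
    "0 < pmf (classifier M (fst p) z) (label M x)" for z
    using wf by (simp_all add: wf_model_def)
  have "- \<HH> p x z = ln (prior M (fst p) z) + fst (snd p) * ln (decoder M (fst p) z x)
      + snd (snd p) * ln (pmf (classifier M (fst p) z) (label M x))" for z
    by (simp add: hamiltonian_def)
  \<comment> \<open>Strict positivity of the densities turns the prior and both powers into
    exponentials of logarithms.\<close>
  then have "boltzmann_weight M x (fst p) (fst (snd p)) (snd (snd p)) z = exp (- \<HH> p x z)" for z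
    using pos[of z] by (simp add: boltzmann_weight_def exp_add powr_def)
  then show ?thesis by (simp add: Z_def partition_fn_def)
qed

lemma J_fun_eq:
  assumes "p \<in> S"
  shows "J_fun M (fst p) (fst (snd p)) (snd (snd p)) = - (\<integral>x. ln (Z p x) \<partial>data_dist M)"
  by (simp add: J_fun_def Z_eq_partition_fn[OF assms])

lemma open_slice: "open {\<theta>. (\<theta>, l, g) \<in> S}"
proof -
  have "open ((\<lambda>\<theta>. (\<theta>, l, g)) -` S)"
    by (intro open_vimage S_open continuous_intros)
  then show ?thesis by (simp add: vimage_def)
qed

lemma GDERIV_J:
  assumes p: "p \<in> S"
  shows "GDERIV (\<lambda>\<theta>. J_fun M \<theta> (fst (snd p)) (snd (snd p))) (fst p) :> (\<integral>x. avg p x (\<GG> p) \<partial>data_dist M)"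
proof -
  let ?e = "\<lambda>\<theta>. (\<theta>, snd p)"
  have e: "(?e has_derivative (\<lambda>h. (h, 0))) (at (fst p))"
    by (auto intro!: derivative_eq_intros)
  have int: "integrable (data_dist M) (\<lambda>x. ln (Z (\<theta>0, l0, g0) x))"
    using fin by (simp add: J_finite_def Z_eq_partition_fn[OF center_in_S])
  have "((\<lambda>q. \<integral>x. ln (Z q x) \<partial>data_dist M) has_derivative
      (\<lambda>v. - (\<integral>x. avg p x (\<lambda>x z. \<HH>' p x z v) \<partial>data_dist M))) (at (?e (fst p)))"
    using has_derivative_expected_ln_Z[OF center_in_S int p] by simp
  from has_derivative_minus[OF has_derivative_compose[OF e this]]
  have "((\<lambda>\<theta>. - (\<integral>x. ln (Z (?e \<theta>) x) \<partial>data_dist M)) has_derivative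
      (\<lambda>h. \<integral>x. avg p x (\<lambda>x z. \<HH>' p x z (h, 0)) \<partial>data_dist M)) (at (fst p))"
    by simp
  \<comment> \<open>Pulling \<open>h\<close> out of both integrals identifies the Riesz
    representative of the derivative, which is the gradient.\<close>
  moreover have "(\<integral>x. avg p x (\<lambda>x z. \<HH>' p x z (h, 0)) \<partial>data_dist M)
      = h \<bullet> (\<integral>x. avg p x (\<GG> p) \<partial>data_dist M)" for h
  proof -
    have "avg p x (\<lambda>x z. \<HH>' p x z (h, 0)) = h \<bullet> avg p x (\<GG> p)" for x
      using avg_bounded_linear[OF bounded_linear_inner_right[of h] p dominated_Q[OF p], of x]
      by (simp add: \<HH>'_def)
    then show ?thesis
      using integral_bounded_linear[OF bounded_linear_inner_right[of h] integrable_avg[OF p dominated_Q[OF p]]]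
      by simp
  qed
  ultimately have "((\<lambda>\<theta>. - (\<integral>x. ln (Z (?e \<theta>) x) \<partial>data_dist M)) has_derivative
      (\<lambda>h. h \<bullet> (\<integral>x. avg p x (\<GG> p) \<partial>data_dist M))) (at (fst p))"
    by simp
  then show ?thesis
    unfolding gderiv_def
    by (rule has_derivative_transform_within_open[OF _ open_slice[of "fst (snd p)" "snd (snd p)"]])
      (use p J_fun_eq[of "(_, snd p)"] in auto)
qed

lemma grad_J_eq:
  assumes "p \<in> S"
  shows "grad_J M (fst p) (fst (snd p)) (snd (snd p)) = (\<integral>x. avg p x (\<GG> p) \<partial>data_dist M)"
  unfolding grad_J_def using GDERIV_J[OF assms] by (rule grad_eq)

text \<open>The total derivative of \<open>grad_J\<close> in the triple; its blocks are
  \<open>A_mat\<close>, \<open>- b_lam\<close> and \<open>- b_gam\<close>.\<close>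

definition L :: "(real^'n) \<times> real \<times> real \<Rightarrow> (real^'n) \<times> real \<times> real \<Rightarrow> real^'n" where
  "L p v = (\<integral>x. avg' p x v \<partial>data_dist M)"

lemma grad_J_has_derivative:
  assumes p: "p \<in> S"
  shows "((\<lambda>p. grad_J M (fst p) (fst (snd p)) (snd (snd p))) has_derivative L p) (at p)"
proof -
  have "((\<lambda>p. \<integral>x. avg p x (\<GG> p) \<partial>data_dist M) has_derivative L p) (at p)"
    using dominated_derivative.has_derivative_integral_param[OF dominated_derivative_avg[OF p] p]
    unfolding L_def[abs_def] .
  then show ?thesis
    by (rule has_derivative_transform_within_open[OF _ S_open p]) (simp add: grad_J_eq)
qed

lemma linear_L: "p \<in> S \<Longrightarrow> linear (L p)"
  using grad_J_has_derivative has_derivative_linear by blast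

text \<open>\<open>A_mat\<close> is defined as a Jacobian, which says something only once
  differentiability is known; uniqueness of the derivative then identifies it with the
  \<theta>-block of \<open>L\<close>.\<close>

lemma grad_J_has_derivative_params:
  assumes p: "p \<in> S"
  shows "((\<lambda>\<theta>. grad_J M \<theta> (fst (snd p)) (snd (snd p))) has_derivative
    (\<lambda>h. A_mat M (fst p) (fst (snd p)) (snd (snd p)) *v h)) (at (fst p))" (is ?A)
    and "A_mat M (fst p) (fst (snd p)) (snd (snd p)) *v h = L p (h, 0)"
proof -
  have e: "((\<lambda>\<theta>. (\<theta>, snd p)) has_derivative (\<lambda>h. (h, 0))) (at (fst p))"
    by (auto intro!: derivative_eq_intros)
  have "((\<lambda>\<theta>. grad_J M \<theta> (fst (snd p)) (snd (snd p))) has_derivative (\<lambda>h. L p (h, 0))) (at (fst p))"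
    using has_derivative_compose[OF e, of "\<lambda>p. grad_J M (fst p) (fst (snd p)) (snd (snd p))" "L p"]
      grad_J_has_derivative[OF p] by simp
  moreover from this show ?A
    using hess_has_derivative[of "\<lambda>\<theta>. J_fun M \<theta> (fst (snd p)) (snd (snd p))" "fst p"]
    unfolding grad_J_def[abs_def] A_mat_def by (auto simp: differentiable_def)
  ultimately have "(\<lambda>h. L p (h, 0)) = (*v) (A_mat M (fst p) (fst (snd p)) (snd (snd p)))"
    by (rule has_derivative_unique)
  then show "A_mat M (fst p) (fst (snd p)) (snd (snd p)) *v h = L p (h, 0)"
    by metis
qed

lemma grad_J_has_vector_derivative_lam:
  assumes p: "p \<in> S"
  shows "((\<lambda>l. grad_J M (fst p) l (snd (snd p))) has_vector_derivative L p (0, 1, 0)) (at (fst (snd p)))"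
proof -
  have e: "((\<lambda>l. (fst p, l, snd (snd p))) has_derivative (\<lambda>h. (0, h, 0))) (at (fst (snd p)))"
    by (auto intro!: derivative_eq_intros)
  have "((\<lambda>l. grad_J M (fst p) l (snd (snd p))) has_derivative (\<lambda>h. L p (0, h, 0))) (at (fst (snd p)))"
    using has_derivative_compose[OF e, of "\<lambda>p. grad_J M (fst p) (fst (snd p)) (snd (snd p))" "L p"]
      grad_J_has_derivative[OF p] by simp
  moreover have "(\<lambda>h. L p (0, h, 0)) = (\<lambda>h. h *\<^sub>R L p (0, 1, 0))"
  proof
    fix h :: real
    have "(0, h, 0) = h *\<^sub>R ((0, 1, 0) :: (real^'n) \<times> real \<times> real)" by simp
    then show "L p (0, h, 0) = h *\<^sub>R L p (0, 1, 0)"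
      by (metis linear_scale[OF linear_L[OF p]])
  qed
  ultimately show ?thesis unfolding has_vector_derivative_def by (simp only:)
qed

lemma grad_J_has_vector_derivative_gam:
  assumes p: "p \<in> S"
  shows "((\<lambda>g. grad_J M (fst p) (fst (snd p)) g) has_vector_derivative L p (0, 0, 1)) (at (snd (snd p)))"
proof -
  have e: "((\<lambda>g. (fst p, fst (snd p), g)) has_derivative (\<lambda>h. (0, 0, h))) (at (snd (snd p)))"
    by (auto intro!: derivative_eq_intros)
  have "((\<lambda>g. grad_J M (fst p) (fst (snd p)) g) has_derivative (\<lambda>h. L p (0, 0, h))) (at (snd (snd p)))"
    using has_derivative_compose[OF e, of "\<lambda>p. grad_J M (fst p) (fst (snd p)) (snd (snd p))" "L p"]
      grad_J_has_derivative[OF p] by simp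
  moreover have "(\<lambda>h. L p (0, 0, h)) = (\<lambda>h. h *\<^sub>R L p (0, 0, 1))"
  proof
    fix h :: real
    have "(0, 0, h) = h *\<^sub>R ((0, 0, 1) :: (real^'n) \<times> real \<times> real)" by simp
    then show "L p (0, 0, h) = h *\<^sub>R L p (0, 0, 1)"
      by (metis linear_scale[OF linear_L[OF p]])
  qed
  ultimately show ?thesis unfolding has_vector_derivative_def by (simp only:)
qed

section \<open>Gibbs average formulas for A and the two vectors b\<close>

lemma b_lam_eq:
  "p \<in> S \<Longrightarrow> b_lam M (fst p) (fst (snd p)) (snd (snd p)) = - L p (0, 1, 0)"
  unfolding b_lam_def by (simp add: vector_derivative_at[OF grad_J_has_vector_derivative_lam])

lemma b_gam_eq:
  "p \<in> S \<Longrightarrow> b_gam M (fst p) (fst (snd p)) (snd (snd p)) = - L p (0, 0, 1)"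
  unfolding b_gam_def by (simp add: vector_derivative_at[OF grad_J_has_vector_derivative_gam])

lemma L_lam:
  "L p (0, 1, 0) = (\<integral>x. avg p x (\<lambda>x z. dlam_grad_H M z x (fst p) (fst (snd p)) (snd (snd p)))
     - avg p x (\<lambda>x z. dlam_H M z x (fst p) (fst (snd p)) (snd (snd p)) *\<^sub>R \<GG> p x z)
     + avg p x (\<lambda>x z. dlam_H M z x (fst p) (fst (snd p)) (snd (snd p))) *\<^sub>R avg p x (\<GG> p)
     \<partial>data_dist M)"
  by (simp add: L_def avg'_def \<GG>'_def \<HH>'_def)

lemma L_gam:
  "L p (0, 0, 1) = (\<integral>x. avg p x (\<lambda>x z. dgam_grad_H M z x (fst p) (fst (snd p)) (snd (snd p)))
     - avg p x (\<lambda>x z. dgam_H M z x (fst p) (fst (snd p)) (snd (snd p)) *\<^sub>R \<GG> p x z)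
     + avg p x (\<lambda>x z. dgam_H M z x (fst p) (fst (snd p)) (snd (snd p))) *\<^sub>R avg p x (\<GG> p)
     \<partial>data_dist M)"
  by (simp add: L_def avg'_def \<GG>'_def \<HH>'_def)

text \<open>Matrices are compared through their action on an arbitrary \<open>h\<close>. To move
  this action inside the expectation, each of the three matrix-valued terms is shown to be
  integrable by itself.\<close>

lemma A_mat_eq:
  assumes p: "p \<in> S"
  shows "A_mat M (fst p) (fst (snd p)) (snd (snd p)) =
    (\<integral>x. avg p x (\<lambda>x z. hess_H M z x (fst p) (fst (snd p)) (snd (snd p)))
       + outer (avg p x (\<GG> p)) (avg p x (\<GG> p))
       - avg p x (\<lambda>x z. outer (\<GG> p x z) (\<GG> p x z)) \<partial>data_dist M)"
    (is "?A = (\<integral>x. ?a x + ?b x - ?c x \<partial>_)")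
proof -
  have dom_hess: "dominated 1 p (\<lambda>x z. hess_H M z x (fst p) (fst (snd p)) (snd (snd p)))"
    unfolding dominated_def using hess_H_measurable[OF p]
    by (auto simp: case_prod_beta' deriv_size_def)
  have dom_outer: "dominated 1 p (\<lambda>x z. outer (\<GG> p x z) (\<GG> p x z))"
  proof -
    have "(\<lambda>q. outer (\<GG> p (fst q) (snd q)) (\<GG> p (fst q) (snd q))) \<in> borel_measurable (borel \<Otimes>\<^sub>M borel)"
      using \<GG>_measurable[OF p] by (intro borel_measurable_matrix) (simp add: outer_mult_vec)
    then show ?thesis
      unfolding dominated_def
      by (auto simp: case_prod_beta' norm_outer deriv_size_def power2_eq_square)
  qed
  have a: "integrable (data_dist M) ?a" by (rule integrable_avg[OF p dom_hess])
  have c: "integrable (data_dist M) ?c" by (rule integrable_avg[OF p dom_outer])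
  \<comment> \<open>The norm of this outer product is the square of the norm of an average, so again
    the square-root bound is what keeps it below \<open>W x\<close>.\<close>
  have b: "integrable (data_dist M) ?b"
  proof (rule Bochner_Integration.integrable_bound[OF W(1)])
    show "?b \<in> borel_measurable (data_dist M)"
      using measurable_avg(1)[OF p dominated_Q[OF p]]
      by (intro borel_measurable_matrix) (simp add: outer_mult_vec)
    show "AE x in data_dist M. norm (?b x) \<le> norm (W x)"
    proof (rule AE_I2)
      fix x
      have "norm (avg p x (\<GG> p)) \<le> 1 * sqrt (avg p x (\<DD> p))"
        using Q_bound[OF p] by (intro norm_avg_le_sqrt[OF p _ dominated_Q[OF p]]) auto
      then have "norm (avg p x (\<GG> p)) * norm (avg p x (\<GG> p))
          \<le> sqrt (avg p x (\<DD> p)) * sqrt (avg p x (\<DD> p))"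
        using avg_D_ge[OF p, of x] by (intro mult_mono) auto
      also have "\<dots> \<le> W x"
        using avg_D_ge[OF p, of x] W(2)[OF p, of x] by simp
      finally show "norm (?b x) \<le> norm (W x)" by (simp add: norm_outer)
    qed
  qed
  have mult: "(?a x + ?b x - ?c x) *v h = avg' p x (h, 0)" for x h
  proof -
    have "?a x *v h = avg p x (\<lambda>x z. \<GG>' p x z (h, 0))"
      using avg_bounded_linear[OF bounded_linear_matrix_vector_mult_left[of h] p dom_hess, of x]
      by (simp add: \<GG>'_def)
    moreover have "?c x *v h = avg p x (\<lambda>x z. \<HH>' p x z (h, 0) *\<^sub>R \<GG> p x z)"
      using avg_bounded_linear[OF bounded_linear_matrix_vector_mult_left[of h] p dom_outer, of x]
      by (simp add: \<HH>'_def outer_mult_vec inner_commute)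
    moreover have "?b x *v h = avg p x (\<lambda>x z. \<HH>' p x z (h, 0)) *\<^sub>R avg p x (\<GG> p)"
      using avg_bounded_linear[OF bounded_linear_inner_right[of h] p dominated_Q[OF p], of x]
      by (simp add: \<HH>'_def outer_mult_vec inner_commute)
    ultimately show ?thesis
      by (simp add: avg'_def matrix_vector_mult_add_rdistrib matrix_vector_mult_diff_rdistrib)
  qed
  have "?A *v h = (\<integral>x. ?a x + ?b x - ?c x \<partial>data_dist M) *v h" for h
    using integral_bounded_linear[OF bounded_linear_matrix_vector_mult_left[of h], of "data_dist M"
        "\<lambda>x. ?a x + ?b x - ?c x"] a b c
    by (simp add: mult grad_J_has_derivative_params(2)[OF p] L_def)
  then show ?thesis by (simp add: matrix_eq)
qed

text \<open>\<open>C2_on\<close> supplies continuity of the second \<theta>-derivatives; the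
  remaining ingredients are continuous because they are differentiable, and the multipliers enter
  affinely.\<close>

lemma continuous_on_L: "continuous_on S (\<lambda>p. L p v)"
  unfolding L_def
proof (rule continuous_on_expected_avg')
  have fst_S: "fst ` S \<subseteq> ball \<theta>0 r" using in_S(1) by blast
  have comp: "continuous_on S (\<lambda>p. f (fst p))" if "continuous_on (ball \<theta>0 r) f"
    for f :: "real^'n \<Rightarrow> 'c::topological_space"
    using continuous_on_compose2[OF that continuous_on_fst[OF continuous_on_id] fst_S] .
  have cH: "continuous_on S (\<lambda>p. hamiltonian M z x (fst p) l g)" for x z l g
    using GDERIV_hamiltonian unfolding gderiv_def
    by (intro comp) (meson continuous_at_imp_continuous_on has_derivative_continuous)
  have cG: "continuous_on S (\<lambda>p. grad_H M z x (fst p) l g)" for x z l g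
    using grad_H_has_derivative
    by (intro comp) (meson continuous_at_imp_continuous_on has_derivative_continuous)
  have ch: "continuous_on S (\<lambda>p. hess_H M z x (fst p) l g)" for x z l g
    using C2[of z x l g] by (intro comp) (simp add: C2_on_def hess_H_def[abs_def])
  have "continuous_on S (\<lambda>p. hess_H M z x (fst p) 0 0
     + fst (snd p) *\<^sub>R (hess_H M z x (fst p) 1 0 - hess_H M z x (fst p) 0 0)
     + snd (snd p) *\<^sub>R (hess_H M z x (fst p) 0 1 - hess_H M z x (fst p) 0 0))" for x z
    by (intro continuous_intros ch)
  then have "continuous_on S (\<lambda>p. hess_H M z x (fst p) (fst (snd p)) (snd (snd p)))" for x z
    by (rule continuous_on_cong[THEN iffD1, OF refl, rotated])
      (simp add: hess_H_affine[OF in_S(1), of _ z x "fst (snd _)" "snd (snd _)"])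
  then have "continuous_on S (\<lambda>p. hess_H M z x (fst p) (fst (snd p)) (snd (snd p)) *v fst v)" for x z
    by (rule bounded_linear.continuous_on[OF bounded_linear_matrix_vector_mult_left])
  moreover have "continuous_on S (\<lambda>p. fst (snd v) *\<^sub>R (grad_H M z x (fst p) 1 0 - grad_H M z x (fst p) 0 0)
     + snd (snd v) *\<^sub>R (grad_H M z x (fst p) 0 1 - grad_H M z x (fst p) 0 0))" for x z
    by (intro continuous_intros cG)
  ultimately have "continuous_on S (\<lambda>p. hess_H M z x (fst p) (fst (snd p)) (snd (snd p)) *v fst v
     + (fst (snd v) *\<^sub>R (grad_H M z x (fst p) 1 0 - grad_H M z x (fst p) 0 0)
     + snd (snd v) *\<^sub>R (grad_H M z x (fst p) 0 1 - grad_H M z x (fst p) 0 0)))" for x z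
    by (rule continuous_on_add)
  then show "continuous_on S (\<lambda>q. \<GG>' q x z v)" for x z
    by (rule continuous_on_cong[THEN iffD1, OF refl, rotated])
      (simp add: \<GG>'_def dlam_grad_H_eq[OF in_S(1)] dgam_grad_H_eq[OF in_S(1)] add.assoc)
  have "continuous_on S (\<lambda>p. \<GG> p x z)" for x z
    using \<GG>_has_derivative by (meson continuous_at_imp_continuous_on has_derivative_continuous)
  then show "continuous_on S (\<lambda>q. \<HH>' q x z v)" for x z
    unfolding \<HH>'_def dlam_H_eq dgam_H_eq by (intro continuous_intros cH)
qed

text \<open>Entry \<open>(i, j)\<close> is coordinate \<open>i\<close> of \<open>L\<close> in the
  basis direction \<open>j\<close>, which reduces the claim to continuity of \<open>L\<close> along
  the slice with fixed multipliers.\<close>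

lemma A_mat_continuous:
  assumes p: "p \<in> S"
  shows "((\<lambda>\<theta>. A_mat M \<theta> (fst (snd p)) (snd (snd p))) \<longlongrightarrow> A_mat M (fst p) (fst (snd p)) (snd (snd p)))
    (nhds (fst p))"
proof (intro vec_tendstoI)
  fix i j
  let ?l = "fst (snd p)" and ?g = "snd (snd p)"
  have A: "A_mat M \<theta> ?l ?g $ i $ j = L (\<theta>, ?l, ?g) (axis j 1, 0) $ i" if "(\<theta>, ?l, ?g) \<in> S" for \<theta>
    using grad_J_has_derivative_params(2)[OF that, of "axis j 1"]
    by (metis fst_conv snd_conv matrix_vector_mult_basis column_def vec_lambda_beta)
  have "isCont (\<lambda>q. L q (axis j 1, 0) $ i) p"
    using continuous_on_L[of "(axis j 1, 0)"] p S_open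
    by (intro continuous_intros) (simp add: continuous_on_eq_continuous_at)
  moreover have "((\<lambda>\<theta>. (\<theta>, ?l, ?g)) \<longlongrightarrow> p) (nhds (fst p))"
    by (cases p) (auto intro!: tendsto_intros simp: tendsto_ident_at filterlim_ident)
  ultimately have "((\<lambda>\<theta>. L (\<theta>, ?l, ?g) (axis j 1, 0) $ i) \<longlongrightarrow> L p (axis j 1, 0) $ i) (nhds (fst p))"
    by (rule isCont_tendsto_compose)
  moreover have "\<forall>\<^sub>F \<theta> in nhds (fst p). L (\<theta>, ?l, ?g) (axis j 1, 0) $ i = A_mat M \<theta> ?l ?g $ i $ j"
    using open_slice[of ?l ?g] p A by (auto simp: eventually_nhds)
  ultimately show "((\<lambda>\<theta>. A_mat M \<theta> ?l ?g $ i $ j) \<longlongrightarrow> A_mat M (fst p) ?l ?g $ i $ j) (nhds (fst p))"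
    using A[of "fst p"] p by (auto elim: Lim_transform_eventually)
qed

end

text \<open>The radius is the smaller of one from the interior of the parameter set and one from
  \<open>regular_near\<close>; shrinking preserves all majorants.\<close>

lemma regular_model_exists:
  assumes "wf_model M" "\<theta>0 \<in> interior (params M)" "regular_near M \<theta>0 l0 g0" "J_finite M \<theta>0 l0 g0"
  obtains r w W where "regular_model M \<theta>0 l0 g0 r w W"
proof -
  obtain r1 where r1: "r1 > 0" "ball \<theta>0 r1 \<subseteq> params M"
    using assms(2) by (meson mem_interior)
  obtain r2 where r2: "r2 > 0" "\<And>x z l g. C2_on (ball \<theta>0 r2) (\<lambda>\<theta>. hamiltonian M z x \<theta> l g)"
    and w: "\<And>x. \<exists>w. integrable lborel w \<and>
           (\<forall>\<theta>\<in>ball \<theta>0 r2. \<forall>l\<in>ball l0 r2. \<forall>g\<in>ball g0 r2. \<forall>z.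
              exp (- hamiltonian M z x \<theta> l g) * deriv_size M x \<theta> l g z \<le> w z)"
    and W: "\<exists>W. integrable (data_dist M) W \<and>
           (\<forall>\<theta>\<in>ball \<theta>0 r2. \<forall>l\<in>ball l0 r2. \<forall>g\<in>ball g0 r2. \<forall>x.
              gibbs_avg (\<lambda>z. hamiltonian M z x \<theta> l g) (deriv_size M x \<theta> l g) \<le> W x)"
    using assms(3) unfolding regular_near_def by metis
  from w obtain w where w: "\<And>x. integrable lborel (w x)"
    "\<And>x \<theta> l g z. \<theta> \<in> ball \<theta>0 r2 \<Longrightarrow> l \<in> ball l0 r2 \<Longrightarrow> g \<in> ball g0 r2 \<Longrightarrow>
       exp (- hamiltonian M z x \<theta> l g) * deriv_size M x \<theta> l g z \<le> w x z"
    by metis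
  from W obtain W where W: "integrable (data_dist M) W"
    "\<And>x \<theta> l g. \<theta> \<in> ball \<theta>0 r2 \<Longrightarrow> l \<in> ball l0 r2 \<Longrightarrow> g \<in> ball g0 r2 \<Longrightarrow>
       gibbs_avg (\<lambda>z. hamiltonian M z x \<theta> l g) (deriv_size M x \<theta> l g) \<le> W x"
    by metis
  have sub: "ball a (min r1 r2) \<subseteq> ball a r2" for a :: "'q::metric_space" by auto
  have "regular_model M \<theta>0 l0 g0 (min r1 r2) w W"
  proof
    show "ball \<theta>0 (min r1 r2) \<subseteq> params M" using r1 by auto
    show "C2_on (ball \<theta>0 (min r1 r2)) (\<lambda>\<theta>. hamiltonian M z x \<theta> l g)" for x z l g
      using r2(2)[of z x l g] sub unfolding C2_on_def by (meson continuous_on_subset subsetD)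
  qed (use assms r1 r2 w W subsetD[OF sub] in auto)
  then show ?thesis by (rule that)
qed

section \<open>Evolution of the path and local strict convexity\<close>

context regular_model
begin

text \<open>The pair of multipliers is the driving variable of the implicit path and
  \<open>B\<close> is multiplication by the inverse of the Hessian. The minus sign of the implicit
  derivative cancels against the signs in \<open>b_lam\<close> and \<open>b_gam\<close>.\<close>

lemma has_vector_derivative_path:
  assumes y: "continuous (at t within T) y" "y t = \<theta>0"
    and lam: "(lam has_real_derivative lam') (at t within T)" "lam t = l0"
    and gam: "(gam has_real_derivative gam') (at t within T)" "gam t = g0"
    and evol: "((\<lambda>s. grad_J M (y s) (lam s) (gam s)) has_vector_derivative 0) (at t within T)"
    and inv: "invertible (A_mat M \<theta>0 l0 g0)"
  shows "(y has_vector_derivative (lam' *\<^sub>R (matrix_inv (A_mat M \<theta>0 l0 g0) *v b_lam M \<theta>0 l0 g0)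
     + gam' *\<^sub>R (matrix_inv (A_mat M \<theta>0 l0 g0) *v b_gam M \<theta>0 l0 g0))) (at t within T)"
proof -
  let ?p = "(\<theta>0, l0, g0)" and ?B = "\<lambda>v. matrix_inv (A_mat M \<theta>0 l0 g0) *v v"
  note p = center_in_S
  have u: "((\<lambda>s. (lam s, gam s)) has_vector_derivative (lam', gam')) (at t within T)"
    using has_derivative_Pair[OF lam(1)[unfolded has_field_derivative_def]
        gam(1)[unfolded has_field_derivative_def]]
    by (simp add: has_vector_derivative_def mult.commute)
  have "(y has_vector_derivative - ?B (L ?p (0, (lam', gam')))) (at t within T)"
  proof (rule has_vector_derivative_implicit_path[where B = ?B and L = "L ?p"
        and \<Gamma> = "\<lambda>p. grad_J M (fst p) (fst (snd p)) (snd (snd p))", OF _ _ _ y(1) u])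
    show "((\<lambda>p. grad_J M (fst p) (fst (snd p)) (snd (snd p))) has_derivative L ?p) (at (y t, lam t, gam t))"
      using grad_J_has_derivative[OF p] y lam gam by simp
    show "bounded_linear ?B" by (rule matrix_vector_mul_bounded_linear)
    show "?B (L ?p (h, 0)) = h" for h
    proof -
      \<comment> \<open>\<open>matrix_inv\<close> selects some matrix satisfying both inverse
        equations, and invertibility says that one exists.\<close>
      have "matrix_inv (A_mat M \<theta>0 l0 g0) ** A_mat M \<theta>0 l0 g0 = mat 1"
        using inv unfolding invertible_def matrix_inv_def by (rule someI2_ex) blast
      moreover have "L ?p (h, 0) = A_mat M \<theta>0 l0 g0 *v h"
        using grad_J_has_derivative_params(2)[OF p, of h] by simp
      ultimately show ?thesis by (simp add: matrix_vector_mul_assoc)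
    qed
    show "((\<lambda>s. grad_J M (fst (y s, lam s, gam s)) (fst (snd (y s, lam s, gam s)))
        (snd (snd (y s, lam s, gam s)))) has_vector_derivative 0) (at t within T)"
      using evol by simp
  qed
  moreover have "L ?p (0, lam', gam') = lam' *\<^sub>R L ?p (0, 1, 0) + gam' *\<^sub>R L ?p (0, 0, 1)"
  proof -
    have "(0, lam', gam') = lam' *\<^sub>R (0 :: real^'n, 1 :: real, 0 :: real) + gam' *\<^sub>R (0, 0, 1)" by simp
    then show ?thesis by (metis linear_add[OF linear_L[OF p]] linear_scale[OF linear_L[OF p]])
  qed
  ultimately show ?thesis
    using b_lam_eq[OF p] b_gam_eq[OF p]
    by (simp add: matrix_vector_right_distrib matrix_vector_mult_scaleR
        linear_neg[OF matrix_vector_mul_linear])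
qed

text \<open>Minimality controls the Hessian at \<open>\<theta>0\<close> alone, so convexity is
  obtained on a neighbourhood. The ball of radius \<open>min r d\<close> is convex and lies both
  where \<open>J\<close> is twice differentiable and where the Hessian is positive definite.\<close>

lemma strictly_convex_neighbourhood:
  assumes min: "\<And>\<theta>. \<theta> \<in> params M \<Longrightarrow> J_fun M \<theta>0 l0 g0 \<le> J_fun M \<theta> l0 g0"
    and inv: "invertible (A_mat M \<theta>0 l0 g0)"
  shows "\<exists>U. open U \<and> \<theta>0 \<in> U \<and> U \<subseteq> params M \<and> strictly_convex_on U (\<lambda>\<theta>. J_fun M \<theta> l0 g0) \<and>
    (\<forall>\<theta>\<in>U. (\<lambda>\<theta>. J_fun M \<theta> l0 g0) differentiable (at \<theta>) \<and>
       ((\<lambda>\<theta>. grad_J M \<theta> l0 g0) has_derivative (\<lambda>h. A_mat M \<theta> l0 g0 *v h)) (at \<theta>))"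
proof -
  \<comment> \<open>With the multipliers fixed at the center, the product distance equals the
    distance in \<theta>, so the slice of \<open>S\<close> contains the full ball.\<close>
  have inS: "(\<theta>, l0, g0) \<in> S" if "\<theta> \<in> ball \<theta>0 r" for \<theta>
    using that by (simp add: S_def dist_prod_def)
  have G: "GDERIV (\<lambda>\<theta>. J_fun M \<theta> l0 g0) \<theta> :> grad_J M \<theta> l0 g0" if "\<theta> \<in> ball \<theta>0 r" for \<theta>
    using GDERIV_J[OF inS[OF that]] grad_J_eq[OF inS[OF that]] by simp
  have A: "((\<lambda>\<theta>. grad_J M \<theta> l0 g0) has_derivative (\<lambda>h. A_mat M \<theta> l0 g0 *v h)) (at \<theta>)"
    if "\<theta> \<in> ball \<theta>0 r" for \<theta>
    using grad_J_has_derivative_params(1)[OF inS[OF that]] by simp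
  have c: "\<theta>0 \<in> ball \<theta>0 r" using r by simp
  have "0 < h \<bullet> (A_mat M \<theta>0 l0 g0 *v h)" if "h \<noteq> 0" for h
  proof (rule positive_definite_if_invertible[OF _ _ inv that])
    show "h \<bullet> (A_mat M \<theta>0 l0 g0 *v k) = k \<bullet> (A_mat M \<theta>0 l0 g0 *v h)" for h k
      by (rule symmetric_second_derivative[OF open_ball c G A[OF c]])
    show "0 \<le> h \<bullet> (A_mat M \<theta>0 l0 g0 *v h)" for h
      by (rule second_derivative_nonneg_at_minimum[OF open_ball c G A[OF c]]) (use min params in auto)
  qed
  then have "\<forall>\<^sub>F \<theta> in nhds \<theta>0. \<forall>h. h \<noteq> 0 \<longrightarrow> 0 < h \<bullet> (A_mat M \<theta> l0 g0 *v h)"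
    using A_mat_continuous[OF center_in_S]
    by (intro eventually_positive_definite[where A = "\<lambda>\<theta>. A_mat M \<theta> l0 g0"]) auto
  then obtain d where d: "d > 0"
    "\<And>\<theta> h. \<theta> \<in> ball \<theta>0 d \<Longrightarrow> h \<noteq> 0 \<Longrightarrow> 0 < h \<bullet> (A_mat M \<theta> l0 g0 *v h)"
    unfolding eventually_nhds_metric by (metis dist_commute mem_ball)
  let ?U = "ball \<theta>0 (min r d)"
  have sub: "\<theta> \<in> ball \<theta>0 r" "\<theta> \<in> ball \<theta>0 d" if "\<theta> \<in> ?U" for \<theta> using that by auto
  have "strictly_convex_on ?U (\<lambda>\<theta>. J_fun M \<theta> l0 g0)"
    by (rule strictly_convex_on_second_derivative[OF convex_ball G[OF sub(1)] A[OF sub(1)] d(2)[OF sub(2)]])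
  moreover have "(\<lambda>\<theta>. J_fun M \<theta> l0 g0) differentiable (at \<theta>)" if "\<theta> \<in> ?U" for \<theta>
    using G[OF sub(1)[OF that]] unfolding gderiv_def by (rule differentiableI)
  moreover have "?U \<subseteq> params M" using params sub(1) by blast
  ultimately show ?thesis
    using A[OF sub(1)] r d by (intro exI[of _ ?U]) auto
qed

end

theorem lemma5:
  fixes M :: "('x::euclidean_space, 'y::countable, 'z::euclidean_space, 'n::finite) latent_model"
    and T :: "real set"
    and \<theta> :: "real \<Rightarrow> real^'n"
    and lam gam lam' gam' :: "real \<Rightarrow> real"
  assumes model: "wf_model M"
    and time: "is_interval T" "interior T \<noteq> {}"
    and lam: "\<And>t. t \<in> T \<Longrightarrow> (lam has_real_derivative lam' t) (at t within T)"
    and gam: "\<And>t. t \<in> T \<Longrightarrow> (gam has_real_derivative gam' t) (at t within T)"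
    and J_finite: "\<And>t \<theta>'. t \<in> T \<Longrightarrow> \<theta>' \<in> params M \<Longrightarrow> J_finite M \<theta>' (lam t) (gam t)"
    and J_bdd: "\<And>t. t \<in> T \<Longrightarrow> bdd_below ((\<lambda>\<theta>'. J_fun M \<theta>' (lam t) (gam t)) ` params M)"
    and evolution: "quasi_static M T \<theta> lam gam"
    and interior: "\<And>t. t \<in> T \<Longrightarrow> \<theta> t \<in> interior (params M)"
    and regular: "\<And>t. t \<in> T \<Longrightarrow> regular_near M (\<theta> t) (lam t) (gam t)"
    and A_invertible: "\<And>t. t \<in> T \<Longrightarrow> invertible (A_mat M (\<theta> t) (lam t) (gam t))"
  shows "\<forall>t\<in>T. let \<theta>\<^sub>t = \<theta> t; l = lam t; g = gam t; p = data_dist M;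
      A = A_mat M \<theta>\<^sub>t l g; b\<^sub>l = b_lam M \<theta>\<^sub>t l g; b\<^sub>g = b_gam M \<theta>\<^sub>t l g;
      h = (\<lambda>x z. hamiltonian M z x \<theta>\<^sub>t l g);
      H\<^sub>\<theta> = (\<lambda>x z. grad_H M z x \<theta>\<^sub>t l g); H\<^sub>\<theta>\<^sub>\<theta> = (\<lambda>x z. hess_H M z x \<theta>\<^sub>t l g);
      H\<^sub>l = (\<lambda>x z. dlam_H M z x \<theta>\<^sub>t l g); H\<^sub>g = (\<lambda>x z. dgam_H M z x \<theta>\<^sub>t l g);
      H\<^sub>l\<^sub>\<theta> = (\<lambda>x z. dlam_grad_H M z x \<theta>\<^sub>t l g); H\<^sub>g\<^sub>\<theta> = (\<lambda>x z. dgam_grad_H M z x \<theta>\<^sub>t l g)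
    in
      (\<theta> has_vector_derivative
         (lam' t *\<^sub>R (matrix_inv A *v b\<^sub>l) + gam' t *\<^sub>R (matrix_inv A *v b\<^sub>g))) (at t within T) \<and>
      (\<theta> has_vector_derivative
         (lam' t *\<^sub>R theta_lam M \<theta>\<^sub>t l g + gam' t *\<^sub>R theta_gam M \<theta>\<^sub>t l g)) (at t within T) \<and>
      ((\<lambda>\<theta>'. grad_J M \<theta>' l g) has_derivative (\<lambda>h. A *v h)) (at \<theta>\<^sub>t) \<and>
      A = (\<integral>x. gibbs_avg (h x) (H\<^sub>\<theta>\<^sub>\<theta> x) + outer (gibbs_avg (h x) (H\<^sub>\<theta> x)) (gibbs_avg (h x) (H\<^sub>\<theta> x))
             - gibbs_avg (h x) (\<lambda>z. outer (H\<^sub>\<theta> x z) (H\<^sub>\<theta> x z)) \<partial>p) \<and>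
      ((\<lambda>l'. grad_J M \<theta>\<^sub>t l' g) has_vector_derivative - b\<^sub>l) (at l) \<and>
      b\<^sub>l = - (\<integral>x. gibbs_avg (h x) (H\<^sub>l\<^sub>\<theta> x) - gibbs_avg (h x) (\<lambda>z. H\<^sub>l x z *\<^sub>R H\<^sub>\<theta> x z)
             + gibbs_avg (h x) (H\<^sub>l x) *\<^sub>R gibbs_avg (h x) (H\<^sub>\<theta> x) \<partial>p) \<and>
      ((\<lambda>g'. grad_J M \<theta>\<^sub>t l g') has_vector_derivative - b\<^sub>g) (at g) \<and>
      b\<^sub>g = - (\<integral>x. gibbs_avg (h x) (H\<^sub>g\<^sub>\<theta> x) - gibbs_avg (h x) (\<lambda>z. H\<^sub>g x z *\<^sub>R H\<^sub>\<theta> x z)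
             + gibbs_avg (h x) (H\<^sub>g x) *\<^sub>R gibbs_avg (h x) (H\<^sub>\<theta> x) \<partial>p) \<and>
      (\<exists>U. open U \<and> \<theta>\<^sub>t \<in> U \<and> U \<subseteq> params M \<and>
         strictly_convex_on U (\<lambda>\<theta>'. J_fun M \<theta>' l g) \<and>
         (\<forall>\<theta>'\<in>U. (\<lambda>\<theta>''. J_fun M \<theta>'' l g) differentiable (at \<theta>') \<and>
            ((\<lambda>\<theta>''. grad_J M \<theta>'' l g) has_derivative (\<lambda>h. A_mat M \<theta>' l g *v h)) (at \<theta>')))"
  unfolding Let_def
proof (intro ballI conjI)
  fix t assume t: "t \<in> T"
  have "\<theta> t \<in> params M" and eq: "J_fun M (\<theta> t) (lam t) (gam t) = F_fun M (lam t) (gam t)"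
    using evolution t by (auto simp: quasi_static_def equilibrium_surface_def)
  then have "J_finite M (\<theta> t) (lam t) (gam t)" using J_finite[OF t] by simp
  then obtain r w W where "regular_model M (\<theta> t) (lam t) (gam t) r w W"
    using regular_model_exists[OF model interior[OF t] regular[OF t]] by blast
  then interpret regular_model M "\<theta> t" "lam t" "gam t" r w W .
  \<comment> \<open>\<open>F_fun\<close> is an infimum; boundedness below makes it a true lower
    bound, so lying on the equilibrium surface means being a minimizer.\<close>
  have min: "J_fun M (\<theta> t) (lam t) (gam t) \<le> J_fun M \<theta>' (lam t) (gam t)" if "\<theta>' \<in> params M" for \<theta>'
    unfolding eq F_fun_def using J_bdd[OF t] that by (rule cINF_lower)
  have path: "(\<theta> has_vector_derivative
      (lam' t *\<^sub>R (matrix_inv (A_mat M (\<theta> t) (lam t) (gam t)) *v b_lam M (\<theta> t) (lam t) (gam t))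
     + gam' t *\<^sub>R (matrix_inv (A_mat M (\<theta> t) (lam t) (gam t)) *v b_gam M (\<theta> t) (lam t) (gam t)))) (at t within T)"
    using evolution t lam[OF t] gam[OF t] A_invertible[OF t]
    by (intro has_vector_derivative_path) (auto simp: quasi_static_def continuous_on_eq_continuous_within)
  then show "(\<theta> has_vector_derivative
      (lam' t *\<^sub>R (matrix_inv (A_mat M (\<theta> t) (lam t) (gam t)) *v b_lam M (\<theta> t) (lam t) (gam t))
     + gam' t *\<^sub>R (matrix_inv (A_mat M (\<theta> t) (lam t) (gam t)) *v b_gam M (\<theta> t) (lam t) (gam t)))) (at t within T)" .
  show "(\<theta> has_vector_derivative (lam' t *\<^sub>R theta_lam M (\<theta> t) (lam t) (gam t)
     + gam' t *\<^sub>R theta_gam M (\<theta> t) (lam t) (gam t))) (at t within T)"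
    using path by (simp only: theta_lam_def theta_gam_def)
  note p = center_in_S
  show "((\<lambda>\<theta>'. grad_J M \<theta>' (lam t) (gam t)) has_derivative
      (\<lambda>h. A_mat M (\<theta> t) (lam t) (gam t) *v h)) (at (\<theta> t))"
    using grad_J_has_derivative_params(1)[OF p] by (simp only: fst_conv snd_conv)
  show "A_mat M (\<theta> t) (lam t) (gam t) = (\<integral>x.
      gibbs_avg (\<lambda>z. hamiltonian M z x (\<theta> t) (lam t) (gam t)) (\<lambda>z. hess_H M z x (\<theta> t) (lam t) (gam t))
      + outer (gibbs_avg (\<lambda>z. hamiltonian M z x (\<theta> t) (lam t) (gam t)) (\<lambda>z. grad_H M z x (\<theta> t) (lam t) (gam t)))
          (gibbs_avg (\<lambda>z. hamiltonian M z x (\<theta> t) (lam t) (gam t)) (\<lambda>z. grad_H M z x (\<theta> t) (lam t) (gam t)))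
      - gibbs_avg (\<lambda>z. hamiltonian M z x (\<theta> t) (lam t) (gam t))
          (\<lambda>z. outer (grad_H M z x (\<theta> t) (lam t) (gam t)) (grad_H M z x (\<theta> t) (lam t) (gam t)))
      \<partial>data_dist M)"
    using A_mat_eq[OF p] by (simp only: fst_conv snd_conv)
  show "((\<lambda>l'. grad_J M (\<theta> t) l' (gam t)) has_vector_derivative - b_lam M (\<theta> t) (lam t) (gam t)) (at (lam t))"
    using grad_J_has_vector_derivative_lam[OF p] b_lam_eq[OF p] by (simp only: fst_conv snd_conv minus_minus)
  show "((\<lambda>g'. grad_J M (\<theta> t) (lam t) g') has_vector_derivative - b_gam M (\<theta> t) (lam t) (gam t)) (at (gam t))"
    using grad_J_has_vector_derivative_gam[OF p] b_gam_eq[OF p] by (simp only: fst_conv snd_conv minus_minus)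
  show "b_lam M (\<theta> t) (lam t) (gam t) = - (\<integral>x.
      gibbs_avg (\<lambda>z. hamiltonian M z x (\<theta> t) (lam t) (gam t)) (\<lambda>z. dlam_grad_H M z x (\<theta> t) (lam t) (gam t))
      - gibbs_avg (\<lambda>z. hamiltonian M z x (\<theta> t) (lam t) (gam t))
          (\<lambda>z. dlam_H M z x (\<theta> t) (lam t) (gam t) *\<^sub>R grad_H M z x (\<theta> t) (lam t) (gam t))
      + gibbs_avg (\<lambda>z. hamiltonian M z x (\<theta> t) (lam t) (gam t)) (\<lambda>z. dlam_H M z x (\<theta> t) (lam t) (gam t))
        *\<^sub>R gibbs_avg (\<lambda>z. hamiltonian M z x (\<theta> t) (lam t) (gam t)) (\<lambda>z. grad_H M z x (\<theta> t) (lam t) (gam t))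
      \<partial>data_dist M)"
    using b_lam_eq[OF p] by (simp only: L_lam fst_conv snd_conv)
  show "b_gam M (\<theta> t) (lam t) (gam t) = - (\<integral>x.
      gibbs_avg (\<lambda>z. hamiltonian M z x (\<theta> t) (lam t) (gam t)) (\<lambda>z. dgam_grad_H M z x (\<theta> t) (lam t) (gam t))
      - gibbs_avg (\<lambda>z. hamiltonian M z x (\<theta> t) (lam t) (gam t))
          (\<lambda>z. dgam_H M z x (\<theta> t) (lam t) (gam t) *\<^sub>R grad_H M z x (\<theta> t) (lam t) (gam t))
      + gibbs_avg (\<lambda>z. hamiltonian M z x (\<theta> t) (lam t) (gam t)) (\<lambda>z. dgam_H M z x (\<theta> t) (lam t) (gam t))
        *\<^sub>R gibbs_avg (\<lambda>z. hamiltonian M z x (\<theta> t) (lam t) (gam t)) (\<lambda>z. grad_H M z x (\<theta> t) (lam t) (gam t))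
      \<partial>data_dist M)"
    using b_gam_eq[OF p] by (simp only: L_gam fst_conv snd_conv)
  show "\<exists>U. open U \<and> \<theta> t \<in> U \<and> U \<subseteq> params M \<and>
      strictly_convex_on U (\<lambda>\<theta>'. J_fun M \<theta>' (lam t) (gam t)) \<and>
      (\<forall>\<theta>'\<in>U. (\<lambda>\<theta>''. J_fun M \<theta>'' (lam t) (gam t)) differentiable (at \<theta>') \<and>
         ((\<lambda>\<theta>''. grad_J M \<theta>'' (lam t) (gam t)) has_derivative
           (\<lambda>h. A_mat M \<theta>' (lam t) (gam t) *v h)) (at \<theta>'))"
    by (rule strictly_convex_neighbourhood[OF min A_invertible[OF t]])
qed

end
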